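(* Let $G$ be a locally compact, non-discrete group with a fixed left Haar measure $\mu$. Then the formula $\varphi(x,y)=\|x-x*y\|=d(x,x*y)$ is unstable with respect to $\mathrm{Th}(L^1(G),* )$.
   Context: Locally compact groups are Hausdorff topological groups. For a locally compact group $G$ with left Haar measure $\mu$, $(L^1(G),* )$ denotes the real Banach lattice $L^1(G,\mu)$ equipped with convolution $(f*g)(x)=\int_G f(y)g(y^{-1}x)\,d\mu(y)$, regarded as a metric structure in continuous first-order logic in the language $\mathcal{L}_{\mathrm{cnv}}=\{+,0,\wedge,\vee,\|\cdot\|,*\}$ with metric $d(f,g)=\|f-g\|_1$; formally one works in the unit ball, treating $+,\wedge,\vee$ as maps from the unit ball to the ball of radius $2$ (or rescaling them by $1/2$). $\mathrm{Th}$ is the complete continuous theory. A formula $\varphi(x,y)$ is unstable with respect to a continuous theory $T$ if there exist a model $M$ of $T$ and sequences $(a_n)_{n<\omega},(b_m)_{m<\omega}$ from $M$ such that both iterated limits $\lim_{n}\lim_{m}\varphi(a_n,b_m)$ and $\lim_{m}\lim_{n}\varphi(a_n,b_m)$ exist and are different. *)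

theory Defs
  imports "HOL-Analysis.Analysis"
begin

section \<open>Continuous first-order logic\<close>

text \<open>
  Real-valued continuous logic for bounded metric structures. A signature fixes, besides the
  arities, a bound on the diameter, a bounded range for each predicate symbol and a modulus of
  uniform continuity for each symbol.
\<close>

record ('f, 'r) signature =
  diam_bound :: real
  fun_arity :: "'f \<Rightarrow> nat"
  fun_modulus :: "'f \<Rightarrow> real \<Rightarrow> real"
  rel_arity :: "'r \<Rightarrow> nat"
  rel_modulus :: "'r \<Rightarrow> real \<Rightarrow> real"
  rel_range :: "'r \<Rightarrow> real set"

record ('f, 'r, 'm) cstructure =
  universe :: "'m set"
  distance :: "'m \<Rightarrow> 'm \<Rightarrow> real"
  fun_interp :: "'f \<Rightarrow> 'm list \<Rightarrow> 'm"
  rel_interp :: "'r \<Rightarrow> 'm list \<Rightarrow> real"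

definition tuples :: "'m set \<Rightarrow> nat \<Rightarrow> 'm list set" where
  "tuples A n = {xs. length xs = n \<and> set xs \<subseteq> A}"

definition metric_structure :: "('f, 'r) signature \<Rightarrow> ('f, 'r, 'm) cstructure \<Rightarrow> bool" where
  "metric_structure L M \<longleftrightarrow>
     universe M \<noteq> {} \<and>
     Metric_space (universe M) (distance M) \<and>
     Metric_space.mcomplete (universe M) (distance M) \<and>
     (\<forall>x\<in>universe M. \<forall>y\<in>universe M. distance M x y \<le> diam_bound L) \<and>
     (\<forall>f. \<forall>xs\<in>tuples (universe M) (fun_arity L f). fun_interp M f xs \<in> universe M) \<and>
     (\<forall>f. \<forall>xs\<in>tuples (universe M) (fun_arity L f). \<forall>ys\<in>tuples (universe M) (fun_arity L f).
        \<forall>\<epsilon>>0. (\<forall>i<fun_arity L f. distance M (xs ! i) (ys ! i) < fun_modulus L f \<epsilon>) \<longrightarrow>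
          distance M (fun_interp M f xs) (fun_interp M f ys) \<le> \<epsilon>) \<and>
     (\<forall>r. \<forall>xs\<in>tuples (universe M) (rel_arity L r). rel_interp M r xs \<in> rel_range L r) \<and>
     (\<forall>r. \<forall>xs\<in>tuples (universe M) (rel_arity L r). \<forall>ys\<in>tuples (universe M) (rel_arity L r).
        \<forall>\<epsilon>>0. (\<forall>i<rel_arity L r. distance M (xs ! i) (ys ! i) < rel_modulus L r \<epsilon>) \<longrightarrow>
          \<bar>rel_interp M r xs - rel_interp M r ys\<bar> \<le> \<epsilon>)"

datatype 'f cterm = Var nat | Fn 'f "'f cterm list"

text \<open>
  \<open>Conn u [\<phi>\<^sub>0, \<dots>, \<phi>\<^sub>k]\<close> applies a continuous connective. The \<open>(k+1)\<close>-ary continuous functions are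
  represented by functions of a sequence, continuous for the product topology and evaluated at
  sequences padded with \<open>0\<close>.
\<close>

datatype ('f, 'r) cformula =
    Dist "'f cterm" "'f cterm"
  | Rel 'r "'f cterm list"
  | Conn "(nat \<Rightarrow> real) \<Rightarrow> real" "('f, 'r) cformula list"
  | SupQ nat "('f, 'r) cformula"
  | InfQ nat "('f, 'r) cformula"

fun wf_cterm :: "('f, 'r) signature \<Rightarrow> 'f cterm \<Rightarrow> bool" where
  "wf_cterm L (Var i) \<longleftrightarrow> True"
| "wf_cterm L (Fn f ts) \<longleftrightarrow> length ts = fun_arity L f \<and> (\<forall>t\<in>set ts. wf_cterm L t)"

fun wf_cformula :: "('f, 'r) signature \<Rightarrow> ('f, 'r) cformula \<Rightarrow> bool" where
  "wf_cformula L (Dist s t) \<longleftrightarrow> wf_cterm L s \<and> wf_cterm L t"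
| "wf_cformula L (Rel r ts) \<longleftrightarrow> length ts = rel_arity L r \<and> (\<forall>t\<in>set ts. wf_cterm L t)"
| "wf_cformula L (Conn u \<phi>s) \<longleftrightarrow> continuous_on UNIV u \<and> (\<forall>\<phi>\<in>set \<phi>s. wf_cformula L \<phi>)"
| "wf_cformula L (SupQ i \<phi>) \<longleftrightarrow> wf_cformula L \<phi>"
| "wf_cformula L (InfQ i \<phi>) \<longleftrightarrow> wf_cformula L \<phi>"

fun cterm_vars :: "'f cterm \<Rightarrow> nat set" where
  "cterm_vars (Var i) = {i}"
| "cterm_vars (Fn f ts) = (\<Union>t\<in>set ts. cterm_vars t)"

fun free_vars :: "('f, 'r) cformula \<Rightarrow> nat set" where
  "free_vars (Dist s t) = cterm_vars s \<union> cterm_vars t"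
| "free_vars (Rel r ts) = (\<Union>t\<in>set ts. cterm_vars t)"
| "free_vars (Conn u \<phi>s) = (\<Union>\<phi>\<in>set \<phi>s. free_vars \<phi>)"
| "free_vars (SupQ i \<phi>) = free_vars \<phi> - {i}"
| "free_vars (InfQ i \<phi>) = free_vars \<phi> - {i}"

fun eval_cterm :: "('f, 'r, 'm) cstructure \<Rightarrow> (nat \<Rightarrow> 'm) \<Rightarrow> 'f cterm \<Rightarrow> 'm" where
  "eval_cterm M \<sigma> (Var i) = \<sigma> i"
| "eval_cterm M \<sigma> (Fn f ts) = fun_interp M f (map (eval_cterm M \<sigma>) ts)"

fun eval :: "('f, 'r, 'm) cstructure \<Rightarrow> (nat \<Rightarrow> 'm) \<Rightarrow> ('f, 'r) cformula \<Rightarrow> real" where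
  "eval M \<sigma> (Dist s t) = distance M (eval_cterm M \<sigma> s) (eval_cterm M \<sigma> t)"
| "eval M \<sigma> (Rel r ts) = rel_interp M r (map (eval_cterm M \<sigma>) ts)"
| "eval M \<sigma> (Conn u \<phi>s) =
     u (\<lambda>i. if i < length \<phi>s then map (eval M \<sigma>) \<phi>s ! i else 0)"
| "eval M \<sigma> (SupQ i \<phi>) = (SUP a\<in>universe M. eval M (\<sigma>(i := a)) \<phi>)"
| "eval M \<sigma> (InfQ i \<phi>) = (INF a\<in>universe M. eval M (\<sigma>(i := a)) \<phi>)"

definition sentence :: "('f, 'r) signature \<Rightarrow> ('f, 'r) cformula \<Rightarrow> bool" where
  "sentence L \<phi> \<longleftrightarrow> wf_cformula L \<phi> \<and> free_vars \<phi> = {}"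

text \<open>A theory is a set of sentences, each \<open>\<phi>\<close> standing for the condition \<open>\<phi> = 0\<close>.\<close>

definition satisfies :: "('f, 'r, 'm) cstructure \<Rightarrow> ('f, 'r) cformula \<Rightarrow> bool" where
  "satisfies M \<phi> \<longleftrightarrow> (\<forall>\<sigma>. range \<sigma> \<subseteq> universe M \<longrightarrow> eval M \<sigma> \<phi> = 0)"

definition Th :: "('f, 'r) signature \<Rightarrow> ('f, 'r, 'm) cstructure \<Rightarrow> ('f, 'r) cformula set" where
  "Th L M = {\<phi>. sentence L \<phi> \<and> satisfies M \<phi>}"

definition is_model ::
    "('f, 'r) signature \<Rightarrow> ('f, 'r) cformula set \<Rightarrow> ('f, 'r, 'm) cstructure \<Rightarrow> bool" where
  "is_model L T M \<longleftrightarrow> metric_structure L M \<and> (\<forall>\<phi>\<in>T. satisfies M \<phi>)"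

text \<open>
  Instability of \<open>\<phi>(x, y)\<close>, where \<open>x\<close> and \<open>y\<close> are the indices of two distinct variables containing
  the free variables of \<open>\<phi>\<close>. The type argument is the type in which the universe of the model
  lives. By the downward Loewenheim-Skolem theorem, for a countable signature the notion does not
  depend on it as long as it has at least continuum many elements.
\<close>

definition unstable ::
    "'m itself \<Rightarrow> ('f, 'r) signature \<Rightarrow> ('f, 'r) cformula set \<Rightarrow>
       nat \<Rightarrow> nat \<Rightarrow> ('f, 'r) cformula \<Rightarrow> bool" where
  "unstable _ L T x y \<phi> \<longleftrightarrow>
     (\<exists>(M :: ('f, 'r, 'm) cstructure) a b. is_model L T M \<and>
        range a \<subseteq> universe M \<and> range b \<subseteq> universe M \<and>
        (let v = (\<lambda>n m. eval M ((\<lambda>_. undefined)(x := a n, y := b m)) \<phi>) in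
          \<exists>(f :: nat \<Rightarrow> real) (g :: nat \<Rightarrow> real) k l.
            (\<forall>n. (\<lambda>m. v n m) \<longlonglongrightarrow> f n) \<and> f \<longlonglongrightarrow> k \<and>
            (\<forall>m. (\<lambda>n. v n m) \<longlonglongrightarrow> g m) \<and> g \<longlonglongrightarrow> l \<and>
            k \<noteq> l))"


section \<open>The convolution lattice of a locally compact group\<close>

text \<open>
  Groups are written additively, but \<open>topological_group_add\<close> does not assume commutativity; so
  \<open>- y + x\<close> below is what is written multiplicatively as the inverse of \<open>y\<close> times \<open>x\<close>.
\<close>

definition left_haar_measure :: "'a::{topological_group_add, t2_space} measure \<Rightarrow> bool" where
  "left_haar_measure \<mu> \<longleftrightarrow>
     sets \<mu> = sets borel \<and>
     emeasure \<mu> (space \<mu>) \<noteq> 0 \<and>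
     (\<forall>K. compact K \<longrightarrow> emeasure \<mu> K < \<infinity>) \<and>
     (\<forall>A\<in>sets borel. emeasure \<mu> A = (INF U\<in>{U. open U \<and> A \<subseteq> U}. emeasure \<mu> U)) \<and>
     (\<forall>U. open U \<longrightarrow> emeasure \<mu> U = (SUP K\<in>{K. compact K \<and> K \<subseteq> U}. emeasure \<mu> K)) \<and>
     (\<forall>g. \<forall>A\<in>sets borel. emeasure \<mu> ((\<lambda>x. g + x) ` A) = emeasure \<mu> A)"

definition L1_class :: "'a measure \<Rightarrow> ('a \<Rightarrow> real) \<Rightarrow> ('a \<Rightarrow> real) set" where
  "L1_class \<mu> f = {h. integrable \<mu> h \<and> (AE x in \<mu>. h x = f x)}"

definition L1_space :: "'a measure \<Rightarrow> ('a \<Rightarrow> real) set set" where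
  "L1_space \<mu> = L1_class \<mu> ` {f. integrable \<mu> f}"

definition L1_rep :: "('a \<Rightarrow> real) set \<Rightarrow> 'a \<Rightarrow> real" where
  "L1_rep F = (SOME f. f \<in> F)"

definition L1_norm :: "'a measure \<Rightarrow> ('a \<Rightarrow> real) set \<Rightarrow> real" where
  "L1_norm \<mu> F = (\<integral>x. \<bar>L1_rep F x\<bar> \<partial>\<mu>)"

definition L1_dist :: "'a measure \<Rightarrow> ('a \<Rightarrow> real) set \<Rightarrow> ('a \<Rightarrow> real) set \<Rightarrow> real" where
  "L1_dist \<mu> F G = (\<integral>x. \<bar>L1_rep F x - L1_rep G x\<bar> \<partial>\<mu>)"

definition group_convolution ::
    "'a::topological_group_add measure \<Rightarrow> ('a \<Rightarrow> real) \<Rightarrow> ('a \<Rightarrow> real) \<Rightarrow> 'a \<Rightarrow> real" where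
  "group_convolution \<mu> f g x = (\<integral>y. f y * g (- y + x) \<partial>\<mu>)"

definition L1_lift2 ::
    "'a measure \<Rightarrow> (('a \<Rightarrow> real) \<Rightarrow> ('a \<Rightarrow> real) \<Rightarrow> 'a \<Rightarrow> real) \<Rightarrow>
       ('a \<Rightarrow> real) set \<Rightarrow> ('a \<Rightarrow> real) set \<Rightarrow> ('a \<Rightarrow> real) set" where
  "L1_lift2 \<mu> p F G = L1_class \<mu> (p (L1_rep F) (L1_rep G))"

datatype cnv_fun = Plus | Zero | Meet | Join | Convol

datatype cnv_rel = Norm

text \<open>
  The structures are unit balls, on which \<open>Plus\<close>, \<open>Meet\<close> and \<open>Join\<close> denote the Banach lattice operations
  rescaled by \<open>1/2\<close>. With this rescaling they are 1-Lipschitz for the maximum metric on pairs,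
  whereas convolution is 2-Lipschitz.
\<close>

definition L_cnv :: "(cnv_fun, cnv_rel) signature" where
  "L_cnv = \<lparr>diam_bound = 2,
     fun_arity = (\<lambda>f. if f = Zero then 0 else 2),
     fun_modulus = (\<lambda>f \<epsilon>. if f = Convol then \<epsilon> / 2 else \<epsilon>),
     rel_arity = (\<lambda>_. 1),
     rel_modulus = (\<lambda>_ \<epsilon>. \<epsilon>),
     rel_range = (\<lambda>_. {0..1})\<rparr>"

definition L1_structure ::
    "'a::topological_group_add measure \<Rightarrow> (cnv_fun, cnv_rel, ('a \<Rightarrow> real) set) cstructure" where
  "L1_structure \<mu> = \<lparr>universe = {F \<in> L1_space \<mu>. L1_norm \<mu> F \<le> 1},
     distance = L1_dist \<mu>,
     fun_interp = (\<lambda>s Fs. case s of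
         Plus \<Rightarrow> L1_lift2 \<mu> (\<lambda>f g x. (f x + g x) / 2) (Fs ! 0) (Fs ! 1)
       | Zero \<Rightarrow> L1_class \<mu> (\<lambda>_. 0)
       | Meet \<Rightarrow> L1_lift2 \<mu> (\<lambda>f g x. min (f x) (g x) / 2) (Fs ! 0) (Fs ! 1)
       | Join \<Rightarrow> L1_lift2 \<mu> (\<lambda>f g x. max (f x) (g x) / 2) (Fs ! 0) (Fs ! 1)
       | Convol \<Rightarrow> L1_lift2 \<mu> (group_convolution \<mu>) (Fs ! 0) (Fs ! 1)),
     rel_interp = (\<lambda>_ Fs. L1_norm \<mu> (Fs ! 0))\<rparr>"

end

theory Submission
  imports Defs
begin

text \<open>
  The structure \<open>L\<^sup>1(G)\<close> itself carries the witnesses. For a set \<open>A\<close> of positive finite measure let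
  \<open>1\<^sub>A / \<mu> A\<close> be its normalised indicator. Since \<open>G\<close> is not discrete, points are null, so there are compact
  sets \<open>V n\<close> with \<open>0 < \<mu> (V n) \<longlonglongrightarrow> 0\<close>; let \<open>a n\<close> be their normalised indicators, and let \<open>b m\<close> be those of
  symmetric open neighbourhoods \<open>U m\<close> of the identity. The functions \<open>a n\<close> and \<open>a n * b m\<close> are probability
  densities and \<open>a n * b m\<close> is bounded both by \<open>1 / \<mu> (V n)\<close> and by \<open>1 / \<mu> (U m)\<close>. As \<open>a n * b m\<close> is supported
  in the sum set of \<open>V n\<close> and \<open>U m\<close>, the first bound shows that their distance is at most
  \<open>2 \<mu> ((V n + U m) - V n) / \<mu> (V n)\<close>, which by outer regularity is small for \<open>n \<le> m\<close> if \<open>U m\<close> is small.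
  By the second bound the distance is at least \<open>2 (1 - \<mu> (V n) / \<mu> (U m))\<close>, which tends to \<open>2\<close> as \<open>n\<close>
  grows. The iterated limits are therefore \<open>0\<close> and \<open>2\<close>.
\<close>

subsection \<open>Tonelli's theorem for Borel functions on products\<close>

text \<open>Most of the work lies in showing that \<open>L1_structure \<mu>\<close> is a metric
  structure at all: convolution must be measurable, integrable and uniformly continuous on classes.
  All of this rests on Tonelli's theorem, and the obstacle is that G need not be second countable
  nor \<mu> sigma-finite. Hence the detour through finite measures with a density, for which open
  covers are countable up to null sets. If G is not metrizable, no sequence of neighbourhoods
  shrinks to the identity. So \<open>U m\<close> is only asked to suit the finitely many sets
  \<open>V 0\<close>, ..., \<open>V m\<close>, which is enough for the limit in m at fixed n. The
  \<open>V n\<close> are compact because compactness is what puts the sum of \<open>V n\<close> and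
  some neighbourhood of the identity inside a given open superset of \<open>V n\<close>. The factors
  2 arise because two probability densities have distance twice the integral of the positive part of
  either difference; each estimate then needs a pointwise bound on one side only.\<close>

lemma measurable_Pair_right_borel: "Pair x \<in> borel \<rightarrow>\<^sub>M borel"
  by (intro borel_measurable_continuous_onI continuous_on_Pair continuous_on_const continuous_on_id)

lemma measurable_Pair_left_borel: "(\<lambda>x. (x, y)) \<in> borel \<rightarrow>\<^sub>M borel"
  by (intro borel_measurable_continuous_onI continuous_on_Pair continuous_on_const continuous_on_id)

lemma open_Pair_vimage: "open W \<Longrightarrow> open (Pair x -` W)"
  by (intro open_vimage continuous_intros)

text \<open>
  When the spaces are not second countable, the Borel sets of a product are in general not in the
  product sigma algebra, so Tonelli's theorem of the library does not cover functions such as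
  \<open>(x, y) \<mapsto> f y * g (- y + x)\<close>. The replacement is based on the following condition, which for
  finite Borel measures is equivalent to \<open>\<tau>\<close>-additivity.
\<close>

locale null_lindelof_measure = finite_measure M
  for M :: "'a::topological_space measure" +
  assumes sets_borel: "sets M = sets borel"
    and null_lindelof: "(\<And>U. U \<in> \<U> \<Longrightarrow> open U) \<Longrightarrow>
      \<exists>\<C>\<subseteq>\<U>. countable \<C> \<and> emeasure M (\<Union>\<U> - \<Union>\<C>) = 0"
begin

lemma space_eq [simp]: "space M = UNIV"
  using sets_eq_imp_space_eq[OF sets_borel] by simp

lemma open_in_sets: "open U \<Longrightarrow> U \<in> sets M"
  by (simp add: sets_borel)

text \<open>Around each point of the section at \<open>x\<close> there is an open rectangle inside
  \<open>W\<close> whose base contains \<open>x\<close>. Countably many heights cover the section up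
  to a null set, so by continuity from below finitely many already exceed \<open>t\<close>, and
  finitely many bases still intersect in an open neighbourhood of \<open>x\<close>.\<close>

lemma ex_rectangle:
  fixes W :: "('b::topological_space \<times> 'a) set"
  assumes W: "open W" and t: "t < measure M (Pair x -` W)"
  shows "\<exists>A B. open A \<and> open B \<and> x \<in> A \<and> A \<times> B \<subseteq> W \<and> t < measure M B"
proof -
  define \<U> where "\<U> = {B. open B \<and> (\<exists>A. open A \<and> x \<in> A \<and> A \<times> B \<subseteq> W)}"
  have U: "\<Union>\<U> = Pair x -` W"
  proof
    show "\<Union>\<U> \<subseteq> Pair x -` W" by (auto simp: \<U>_def)
    show "Pair x -` W \<subseteq> \<Union>\<U>"
    proof
      fix y assume "y \<in> Pair x -` W"
      then have "(x, y) \<in> W" by simp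
      with W obtain A B where "open A" "open B" "(x, y) \<in> A \<times> B" "A \<times> B \<subseteq> W"
        by (rule open_prod_elim)
      then show "y \<in> \<Union>\<U>" by (auto simp: \<U>_def)
    qed
  qed
  obtain \<C> where C: "\<C> \<subseteq> \<U>" "countable \<C>" "emeasure M (\<Union>\<U> - \<Union>\<C>) = 0"
    using null_lindelof[of \<U>] by (auto simp: \<U>_def)
  \<comment> \<open>The empty set is adjoined so that \<open>from_nat_into\<close> enumerates a
    nonempty set even if \<open>\<C>\<close> is empty.\<close>
  have "{} \<in> \<U>" by (auto simp: \<U>_def intro: exI[of _ UNIV])
  define B where "B = from_nat_into (insert {} \<C>)"
  have rB: "range B = insert {} \<C>"
    unfolding B_def using C(2) by (intro range_from_nat_into) auto
  have "insert {} \<C> \<subseteq> \<U>" using C(1) \<open>{} \<in> \<U>\<close> by simp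
  then have BU: "B i \<in> \<U>" for i unfolding rB[symmetric] by (rule subsetD) (rule rangeI)
  then have oB: "open (B i)" for i by (auto simp: \<U>_def)
  from BU have "\<forall>i. \<exists>A. open A \<and> x \<in> A \<and> A \<times> B i \<subseteq> W" by (auto simp: \<U>_def)
  then obtain A where A: "\<And>i. open (A i)" "\<And>i. x \<in> A i" "\<And>i. A i \<times> B i \<subseteq> W" by metis
  have UB: "\<Union>\<C> = (\<Union>i. B i)" using rB by auto
  have oU: "open (\<Union>\<U>)" "open (\<Union>\<C>)" using C(1) by (auto simp: \<U>_def)
  have meq: "measure M (\<Union>\<U>) = measure M (\<Union>\<C>)"
  proof -
    have "measure M (\<Union>\<U> - \<Union>\<C>) = measure M (\<Union>\<U>) - measure M (\<Union>\<C>)"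
      using C(1) oU by (intro finite_measure_Diff open_in_sets) auto
    with C(3) show ?thesis by (simp add: measure_def)
  qed
  have "(\<lambda>n. measure M (\<Union>i<n. B i)) \<longlonglongrightarrow> measure M (\<Union>n. \<Union>i<n. B i)"
    by (intro finite_Lim_measure_incseq)
      (auto intro!: open_in_sets oB simp: incseq_def intro: less_le_trans)
  moreover have "(\<Union>n. \<Union>i<n. B i) = (\<Union>i. B i)" by auto
  ultimately have "(\<lambda>n. measure M (\<Union>i<n. B i)) \<longlonglongrightarrow> measure M (Pair x -` W)"
    using U UB meq by simp
  then have "eventually (\<lambda>n. t < measure M (\<Union>i<n. B i)) sequentially"
    using t by (rule order_tendstoD)
  then obtain n where n: "t < measure M (\<Union>i<n. B i)"
    by (auto simp: eventually_sequentially)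
  show ?thesis
  proof (intro exI conjI)
    show "open (\<Inter>i<n. A i)" "open (\<Union>i<n. B i)" using A oB by auto
    show "x \<in> (\<Inter>i<n. A i)" using A by auto
    show "(\<Inter>i<n. A i) \<times> (\<Union>i<n. B i) \<subseteq> W" using A by blast
    show "t < measure M (\<Union>i<n. B i)" by fact
  qed
qed

lemma section_borel: "E \<in> sets borel \<Longrightarrow> Pair x -` E \<in> sets M"
  using measurable_sets[OF measurable_Pair_right_borel, of E x] by (simp add: sets_borel)

lemma section_borel': "E \<in> sets borel \<Longrightarrow> (\<lambda>x. (x, y)) -` E \<in> sets M"
  using measurable_sets[OF measurable_Pair_left_borel, of E y] by (simp add: sets_borel)

text \<open>Lower semicontinuity: the rectangle found at \<open>x\<close> bounds the section measure
  from below over its whole base. Borel measurability of section measures of open sets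
  follows.\<close>

lemma open_measure_section_gt:
  assumes W: "open W"
  shows "open {x. t < measure M (Pair x -` W)}"
proof (subst open_subopen, intro ballI)
  fix x assume "x \<in> {x. t < measure M (Pair x -` W)}"
  then obtain A B where AB: "open A" "open B" "x \<in> A" "A \<times> B \<subseteq> W" "t < measure M B"
    using ex_rectangle[OF W, of t x] by auto
  have "A \<subseteq> {x. t < measure M (Pair x -` W)}"
  proof
    fix x' assume "x' \<in> A"
    then have "measure M B \<le> measure M (Pair x' -` W)"
      using AB by (intro finite_measure_mono open_in_sets open_Pair_vimage W) auto
    with AB show "x' \<in> {x. t < measure M (Pair x -` W)}" by simp
  qed
  with AB show "\<exists>T. open T \<and> x \<in> T \<and> T \<subseteq> {x. t < measure M (Pair x -` W)}" by blast
qed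

lemma measurable_measure_section_open:
  assumes "open W"
  shows "(\<lambda>x. measure M (Pair x -` W)) \<in> borel_measurable borel"
  unfolding borel_measurable_iff_greater
  using open_measure_section_gt[OF assms] by auto

end

text \<open>For each \<open>t\<close>, countably many bases of rectangles of height above
  \<open>t\<close> cover almost all points lying in any such base. \<open>W'\<close> collects these
  rectangles for rational \<open>t\<close>. If a section of \<open>W'\<close> were smaller than that
  of \<open>W\<close>, a rational in the gap would, off a null set, provide a rectangle in
  \<open>W'\<close> that is too high.\<close>

lemma ex_countable_rectangles:
  fixes \<kappa> :: "'a::topological_space measure" and \<nu> :: "'b::topological_space measure"
  assumes "null_lindelof_measure \<kappa>" "null_lindelof_measure \<nu>" and W: "open W"
  shows "\<exists>W'\<in>sets (borel \<Otimes>\<^sub>M borel). open W' \<and> W' \<subseteq> W \<and>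
    (AE x in \<kappa>. measure \<nu> (Pair x -` W) = measure \<nu> (Pair x -` W'))"
proof -
  interpret \<kappa>: null_lindelof_measure \<kappa> by fact
  interpret \<nu>: null_lindelof_measure \<nu> by fact
  define \<U> where "\<U> t = {A. open A \<and> (\<exists>B. open B \<and> A \<times> B \<subseteq> W \<and> t < measure \<nu> B)}" for t
  have "\<forall>t. \<exists>\<C>. \<C> \<subseteq> \<U> t \<and> countable \<C> \<and> emeasure \<kappa> (\<Union>(\<U> t) - \<Union>\<C>) = 0"
  proof
    fix t
    show "\<exists>\<C>. \<C> \<subseteq> \<U> t \<and> countable \<C> \<and> emeasure \<kappa> (\<Union>(\<U> t) - \<Union>\<C>) = 0"
      by (rule \<kappa>.null_lindelof[of "\<U> t"]) (simp add: \<U>_def)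
  qed
  from choice[OF this] obtain \<C> where
    "\<forall>t. \<C> t \<subseteq> \<U> t \<and> countable (\<C> t) \<and> emeasure \<kappa> (\<Union>(\<U> t) - \<Union>(\<C> t)) = 0" ..
  then have C: "\<And>t. \<C> t \<subseteq> \<U> t" "\<And>t. countable (\<C> t)"
      "\<And>t. emeasure \<kappa> (\<Union>(\<U> t) - \<Union>(\<C> t)) = 0"
    by simp_all
  have CU: "open A \<and> (\<exists>B. open B \<and> A \<times> B \<subseteq> W \<and> t < measure \<nu> B)" if "A \<in> \<C> t" for A t
    using subsetD[OF C(1) that] by (simp add: \<U>_def)
  then have oA: "open A" if "A \<in> \<C> t" for A t using that by blast
  define B where "B t A = (SOME B. open B \<and> A \<times> B \<subseteq> W \<and> t < measure \<nu> B)" for t A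
  have B: "open (B t A)" "A \<times> B t A \<subseteq> W" "t < measure \<nu> (B t A)" if "A \<in> \<C> t" for t A
    using someI_ex[OF conjunct2[OF CU[OF that]]] by (simp_all add: B_def)
  define W' where "W' = (\<Union>t\<in>\<rat>. \<Union>A\<in>\<C> t. A \<times> B t A)"
  have oW': "open W'" unfolding W'_def by (intro open_UN ballI open_Times oA B) auto
  have sub: "W' \<subseteq> W" unfolding W'_def using B by blast
  have "(\<Union>A\<in>\<C> t. A \<times> B t A) \<in> sets (borel \<Otimes>\<^sub>M borel)" for t
    using C(2)[of t] by (rule sets.countable_UN') (intro image_subsetI pair_measureI borel_open oA B)
  then have "W' \<in> sets (borel \<Otimes>\<^sub>M borel)"
    unfolding W'_def using countable_rat by (intro sets.countable_UN') auto
  moreover have "AE x in \<kappa>. measure \<nu> (Pair x -` W) = measure \<nu> (Pair x -` W')"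
  proof -
    have "AE x in \<kappa>. \<forall>t\<in>\<rat>. x \<notin> \<Union>(\<U> t) - \<Union>(\<C> t)"
    proof (intro AE_ball_countable[THEN iffD2] countable_rat ballI AE_not_in)
      fix t :: real
      have "open (\<Union>(\<U> t))" "open (\<Union>(\<C> t))" using oA by (auto simp: \<U>_def)
      then show "\<Union>(\<U> t) - \<Union>(\<C> t) \<in> null_sets \<kappa>"
        using C(3)[of t] by (intro null_setsI sets.Diff \<kappa>.open_in_sets)
    qed
    then show ?thesis
    proof eventually_elim
      case (elim x)
      show ?case
      proof (rule antisym)
        show "measure \<nu> (Pair x -` W') \<le> measure \<nu> (Pair x -` W)"
          using sub by (intro \<nu>.finite_measure_mono \<nu>.open_in_sets open_Pair_vimage W) auto
        show "measure \<nu> (Pair x -` W) \<le> measure \<nu> (Pair x -` W')"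
        proof (rule ccontr)
          assume "\<not> ?thesis"
          then obtain t where t: "t \<in> \<rat>" "measure \<nu> (Pair x -` W') < t" "t < measure \<nu> (Pair x -` W)"
            using Rats_dense_in_real by (metis not_le)
          from \<nu>.ex_rectangle[OF W t(3)] have "x \<in> \<Union>(\<U> t)" by (auto simp: \<U>_def)
          with elim t obtain A where A: "A \<in> \<C> t" "x \<in> A" by blast
          have "measure \<nu> (B t A) \<le> measure \<nu> (Pair x -` W')"
            using A t
            by (intro \<nu>.finite_measure_mono \<nu>.open_in_sets open_Pair_vimage oW') (auto simp: W'_def)
          with B(3)[OF A(1)] t show False by simp
        qed
      qed
    qed
  qed
  ultimately show ?thesis using oW' sub by blast
qed

locale null_lindelof_pair =
  \<kappa>: null_lindelof_measure \<kappa> + \<nu>: null_lindelof_measure \<nu>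
  for \<kappa> :: "'a::topological_space measure" and \<nu> :: "'b::topological_space measure"
begin

text \<open>
  Up to null sections, an open set can be replaced by a countable union of open rectangles, to
  which the library version of Tonelli's theorem applies.
\<close>

lemma open_section_integral_le:
  assumes W: "open W"
  shows "(\<integral>\<^sup>+x. emeasure \<nu> (Pair x -` W) \<partial>\<kappa>) \<le> (\<integral>\<^sup>+y. emeasure \<kappa> ((\<lambda>x. (x, y)) -` W) \<partial>\<nu>)"
proof -
  interpret pair_sigma_finite \<kappa> \<nu> ..
  obtain W' where W': "W' \<in> sets (borel \<Otimes>\<^sub>M borel)" "open W'" "W' \<subseteq> W"
      "AE x in \<kappa>. measure \<nu> (Pair x -` W) = measure \<nu> (Pair x -` W')"
    using ex_countable_rectangles[OF \<kappa>.null_lindelof_measure_axioms \<nu>.null_lindelof_measure_axioms W]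
    by blast
  have s: "W' \<in> sets (\<kappa> \<Otimes>\<^sub>M \<nu>)"
    using W'(1) sets_pair_measure_cong[OF \<kappa>.sets_borel \<nu>.sets_borel] by simp
  have "(\<integral>\<^sup>+x. emeasure \<nu> (Pair x -` W) \<partial>\<kappa>) = (\<integral>\<^sup>+x. emeasure \<nu> (Pair x -` W') \<partial>\<kappa>)"
    using W'(4) by (intro nn_integral_cong_AE) (auto simp: \<nu>.emeasure_eq_measure)
  also have "\<dots> = emeasure (\<kappa> \<Otimes>\<^sub>M \<nu>) W'"
    by (rule \<nu>.emeasure_pair_measure_alt[OF s, symmetric])
  also have "\<dots> = (\<integral>\<^sup>+y. emeasure \<kappa> ((\<lambda>x. (x, y)) -` W') \<partial>\<nu>)"
    by (rule emeasure_pair_measure_alt2[OF s])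
  also have "\<dots> \<le> (\<integral>\<^sup>+y. emeasure \<kappa> ((\<lambda>x. (x, y)) -` W) \<partial>\<nu>)"
    using W'(3) W by (intro nn_integral_mono emeasure_mono \<kappa>.section_borel') auto
  finally show ?thesis .
qed

end

lemma open_swap: "open W \<Longrightarrow> open (prod.swap -` W)"
  by (intro open_vimage continuous_on_swap)

context null_lindelof_pair
begin

text \<open>The equality consists of two inequalities, the second being the first with the factors
  exchanged.\<close>

lemma section_integral_open:
  assumes W: "open W"
  shows "(\<lambda>x. emeasure \<nu> (Pair x -` W)) \<in> borel_measurable borel"
    and "(\<lambda>y. emeasure \<kappa> ((\<lambda>x. (x, y)) -` W)) \<in> borel_measurable borel"
    and "(\<integral>\<^sup>+x. emeasure \<nu> (Pair x -` W) \<partial>\<kappa>) = (\<integral>\<^sup>+y. emeasure \<kappa> ((\<lambda>x. (x, y)) -` W) \<partial>\<nu>)"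
proof -
  interpret swap: null_lindelof_pair \<nu> \<kappa> ..
  have eq: "Pair y -` (prod.swap -` W) = (\<lambda>x. (x, y)) -` W"
    "(\<lambda>y. (y, x)) -` (prod.swap -` W) = Pair x -` W" for x y
    by auto
  show "(\<lambda>x. emeasure \<nu> (Pair x -` W)) \<in> borel_measurable borel"
    using \<nu>.measurable_measure_section_open[OF W] by (simp add: \<nu>.emeasure_eq_measure)
  show "(\<lambda>y. emeasure \<kappa> ((\<lambda>x. (x, y)) -` W)) \<in> borel_measurable borel"
    using \<kappa>.measurable_measure_section_open[OF open_swap[OF W]]
    by (simp add: \<kappa>.emeasure_eq_measure eq)
  show "(\<integral>\<^sup>+x. emeasure \<nu> (Pair x -` W) \<partial>\<kappa>) = (\<integral>\<^sup>+y. emeasure \<kappa> ((\<lambda>x. (x, y)) -` W) \<partial>\<nu>)"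
    using open_section_integral_le[OF W] swap.open_section_integral_le[OF open_swap[OF W]]
    by (simp add: eq)
qed

text \<open>Dynkin's argument: open sets are stable under intersection and generate the Borel sets,
  and the claims pass to complements and disjoint countable unions. Finiteness of both measures
  justifies the subtraction in \<open>ennreal\<close> for complements.\<close>

lemma section_integral_borel:
  assumes E: "E \<in> sets (borel :: ('a \<times> 'b) measure)"
  shows "(\<lambda>x. emeasure \<nu> (Pair x -` E)) \<in> borel_measurable borel \<and>
    (\<lambda>y. emeasure \<kappa> ((\<lambda>x. (x, y)) -` E)) \<in> borel_measurable borel \<and>
    (\<integral>\<^sup>+x. emeasure \<nu> (Pair x -` E) \<partial>\<kappa>) = (\<integral>\<^sup>+y. emeasure \<kappa> ((\<lambda>x. (x, y)) -` E) \<partial>\<nu>)"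
    (is "?P E")
proof -
  have mk: "f \<in> borel_measurable \<kappa> \<longleftrightarrow> f \<in> borel_measurable borel" for f :: "'a \<Rightarrow> ennreal"
    by (rule arg_cong[OF measurable_cong_sets]) (simp_all add: \<kappa>.sets_borel)
  have mn: "f \<in> borel_measurable \<nu> \<longleftrightarrow> f \<in> borel_measurable borel" for f :: "'b \<Rightarrow> ennreal"
    by (rule arg_cong[OF measurable_cong_sets]) (simp_all add: \<nu>.sets_borel)
  have sb: "sigma_sets UNIV {S. open S} = sets (borel :: ('a \<times> 'b) measure)"
    by (simp add: borel_def)
  have "Int_stable {S :: ('a \<times> 'b) set. open S}" by (auto simp: Int_stable_def)
  moreover have "{S :: ('a \<times> 'b) set. open S} \<subseteq> Pow UNIV" by simp
  moreover have "E \<in> sigma_sets UNIV {S. open S}" using E sb by simp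
  ultimately show ?thesis
  proof (induction rule: sigma_sets_induct_disjoint)
    case (basic A)
    then show ?case using section_integral_open[of A] by simp
  next
    case empty
    show ?case by simp
  next
    case (compl A)
    then have A: "A \<in> sets borel" using sb by simp
    have n: "emeasure \<nu> (Pair x -` (UNIV - A)) = emeasure \<nu> UNIV - emeasure \<nu> (Pair x -` A)" for x
      using emeasure_compl[OF \<nu>.section_borel[OF A, of x]]
      by (simp add: vimage_Diff)
    have k: "emeasure \<kappa> ((\<lambda>x. (x, y)) -` (UNIV - A))
        = emeasure \<kappa> UNIV - emeasure \<kappa> ((\<lambda>x. (x, y)) -` A)" for y
      using emeasure_compl[OF \<kappa>.section_borel'[OF A, of y]]
      by (simp add: vimage_Diff)
    have le: "emeasure \<nu> (Pair x -` A) \<le> emeasure \<nu> UNIV"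
      "emeasure \<kappa> ((\<lambda>x. (x, y)) -` A) \<le> emeasure \<kappa> UNIV" for x y
      using emeasure_space[of \<nu>] emeasure_space[of \<kappa>] by auto
    have fin: "(\<integral>\<^sup>+x. emeasure \<nu> (Pair x -` A) \<partial>\<kappa>) \<noteq> \<infinity>"
    proof -
      have "(\<integral>\<^sup>+x. emeasure \<nu> (Pair x -` A) \<partial>\<kappa>) \<le> (\<integral>\<^sup>+x. emeasure \<nu> UNIV \<partial>\<kappa>)"
        by (intro nn_integral_mono le)
      also have "\<dots> < \<infinity>"
        using \<nu>.emeasure_finite[of UNIV] \<kappa>.emeasure_finite[of UNIV]
        by (simp add: ennreal_mult_eq_top_iff less_top[symmetric])
      finally show ?thesis by simp
    qed
    have "(\<integral>\<^sup>+x. emeasure \<nu> (Pair x -` (UNIV - A)) \<partial>\<kappa>)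
        = (\<integral>\<^sup>+x. emeasure \<nu> UNIV \<partial>\<kappa>) - (\<integral>\<^sup>+x. emeasure \<nu> (Pair x -` A) \<partial>\<kappa>)"
      unfolding n using compl fin by (intro nn_integral_diff) (auto simp: mk le)
    also have "\<dots> = (\<integral>\<^sup>+y. emeasure \<kappa> UNIV \<partial>\<nu>) - (\<integral>\<^sup>+y. emeasure \<kappa> ((\<lambda>x. (x, y)) -` A) \<partial>\<nu>)"
      using compl by (simp add: mult.commute)
    also have "\<dots> = (\<integral>\<^sup>+y. emeasure \<kappa> ((\<lambda>x. (x, y)) -` (UNIV - A)) \<partial>\<nu>)"
      unfolding k using compl fin by (intro nn_integral_diff[symmetric]) (auto simp: mn le)
    finally show ?case using compl by (auto simp: n k)
  next
    case (union A)
    then have A: "\<And>i. A i \<in> sets borel" using sb by auto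
    have n: "emeasure \<nu> (Pair x -` (\<Union>i. A i)) = (\<Sum>i. emeasure \<nu> (Pair x -` A i))" for x
      using union(1) A
      by (subst suminf_emeasure)
        (auto simp: disjoint_family_on_def vimage_UN intro!: \<nu>.section_borel)
    have k: "emeasure \<kappa> ((\<lambda>x. (x, y)) -` (\<Union>i. A i)) = (\<Sum>i. emeasure \<kappa> ((\<lambda>x. (x, y)) -` A i))" for y
      using union(1) A
      by (subst suminf_emeasure)
        (auto simp: disjoint_family_on_def vimage_UN intro!: \<kappa>.section_borel')
    have "(\<integral>\<^sup>+x. (\<Sum>i. emeasure \<nu> (Pair x -` A i)) \<partial>\<kappa>)
        = (\<Sum>i. \<integral>\<^sup>+x. emeasure \<nu> (Pair x -` A i) \<partial>\<kappa>)"
      using union(3) by (intro nn_integral_suminf) (simp add: mk)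
    also have "\<dots> = (\<Sum>i. \<integral>\<^sup>+y. emeasure \<kappa> ((\<lambda>x. (x, y)) -` A i) \<partial>\<nu>)"
      using union(3) by simp
    also have "\<dots> = (\<integral>\<^sup>+y. (\<Sum>i. emeasure \<kappa> ((\<lambda>x. (x, y)) -` A i)) \<partial>\<nu>)"
      using union(3) by (intro nn_integral_suminf[symmetric]) (simp add: mn)
    finally show ?case
      unfolding n k using union(3) by (intro conjI borel_measurable_suminf_order) auto
  qed
qed

text \<open>Measurability of both inner integrals is part of the claim because the induction steps
  for sums and suprema integrate them again.\<close>

theorem tonelli_borel:
  fixes F :: "'a \<times> 'b \<Rightarrow> ennreal"
  assumes F: "F \<in> borel_measurable borel"
  shows "(\<lambda>x. \<integral>\<^sup>+y. F (x, y) \<partial>\<nu>) \<in> borel_measurable borel \<and>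
    (\<lambda>y. \<integral>\<^sup>+x. F (x, y) \<partial>\<kappa>) \<in> borel_measurable borel \<and>
    (\<integral>\<^sup>+x. \<integral>\<^sup>+y. F (x, y) \<partial>\<nu> \<partial>\<kappa>) = (\<integral>\<^sup>+y. \<integral>\<^sup>+x. F (x, y) \<partial>\<kappa> \<partial>\<nu>)"
proof -
  have mk: "f \<in> borel_measurable \<kappa> \<longleftrightarrow> f \<in> borel_measurable borel" for f :: "'a \<Rightarrow> ennreal"
    by (rule arg_cong[OF measurable_cong_sets]) (simp_all add: \<kappa>.sets_borel)
  have mn: "f \<in> borel_measurable \<nu> \<longleftrightarrow> f \<in> borel_measurable borel" for f :: "'b \<Rightarrow> ennreal"
    by (rule arg_cong[OF measurable_cong_sets]) (simp_all add: \<nu>.sets_borel)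
  have sx: "(\<lambda>y. G (x, y)) \<in> borel_measurable \<nu>"
    if "G \<in> borel_measurable borel" for G :: "'a \<times> 'b \<Rightarrow> ennreal" and x
    unfolding mn using measurable_compose[OF measurable_Pair_right_borel that] .
  have sy: "(\<lambda>x. G (x, y)) \<in> borel_measurable \<kappa>"
    if "G \<in> borel_measurable borel" for G :: "'a \<times> 'b \<Rightarrow> ennreal" and y
    unfolding mk using measurable_compose[OF measurable_Pair_left_borel that] .
  from F show ?thesis
  proof (induction rule: borel_measurable_induct)
    case (cong f g)
    then have "f = g" by auto
    with cong show ?case by simp
  next
    case (set A)
    have "(\<integral>\<^sup>+y. indicator A (x, y) \<partial>\<nu>) = emeasure \<nu> (Pair x -` A)" for x
      using \<nu>.section_borel[OF set, of x]
      by (simp flip: nn_integral_indicator add: indicator_vimage)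
    moreover have "(\<integral>\<^sup>+x. indicator A (x, y) \<partial>\<kappa>) = emeasure \<kappa> ((\<lambda>x. (x, y)) -` A)" for y
      using \<kappa>.section_borel'[OF set, of y]
      by (simp flip: nn_integral_indicator add: indicator_vimage)
    ultimately show ?case using section_integral_borel[OF set] by simp
  next
    case (mult u c)
    have "(\<integral>\<^sup>+y. c * u (x, y) \<partial>\<nu>) = c * (\<integral>\<^sup>+y. u (x, y) \<partial>\<nu>)"
      "(\<integral>\<^sup>+x. c * u (x, y) \<partial>\<kappa>) = c * (\<integral>\<^sup>+x. u (x, y) \<partial>\<kappa>)" for x y
      using mult by (auto intro!: nn_integral_cmult sx sy)
    then show ?case
      using mult by (auto simp: nn_integral_cmult mk mn)
  next
    case (add u v)
    have "(\<integral>\<^sup>+y. v (x, y) + u (x, y) \<partial>\<nu>) = (\<integral>\<^sup>+y. v (x, y) \<partial>\<nu>) + (\<integral>\<^sup>+y. u (x, y) \<partial>\<nu>)"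
      "(\<integral>\<^sup>+x. v (x, y) + u (x, y) \<partial>\<kappa>) = (\<integral>\<^sup>+x. v (x, y) \<partial>\<kappa>) + (\<integral>\<^sup>+x. u (x, y) \<partial>\<kappa>)" for x y
      using add by (auto intro!: nn_integral_add sx sy)
    then show ?case
      using add by (auto simp: nn_integral_add mk mn)
  next
    case (seq U)
    have inc: "incseq (\<lambda>i y. U i (x, y))" "incseq (\<lambda>i x. U i (x, y))" for x y
      using seq by (auto simp: incseq_def le_fun_def)
    have ix: "(\<integral>\<^sup>+y. (SUP i. U i) (x, y) \<partial>\<nu>) = (SUP i. \<integral>\<^sup>+y. U i (x, y) \<partial>\<nu>)" for x
      unfolding SUP_apply by (rule nn_integral_monotone_convergence_SUP[OF inc(1) sx[OF seq(1)]])
    have iy: "(\<integral>\<^sup>+x. (SUP i. U i) (x, y) \<partial>\<kappa>) = (SUP i. \<integral>\<^sup>+x. U i (x, y) \<partial>\<kappa>)" for y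
      unfolding SUP_apply by (rule nn_integral_monotone_convergence_SUP[OF inc(2) sy[OF seq(1)]])
    have inc': "incseq (\<lambda>i x. \<integral>\<^sup>+y. U i (x, y) \<partial>\<nu>)" "incseq (\<lambda>i y. \<integral>\<^sup>+x. U i (x, y) \<partial>\<kappa>)"
      using inc by (auto simp: incseq_def le_fun_def intro!: nn_integral_mono)
    have "(\<integral>\<^sup>+x. (SUP i. \<integral>\<^sup>+y. U i (x, y) \<partial>\<nu>) \<partial>\<kappa>) = (SUP i. \<integral>\<^sup>+x. \<integral>\<^sup>+y. U i (x, y) \<partial>\<nu> \<partial>\<kappa>)"
      using seq.IH by (intro nn_integral_monotone_convergence_SUP inc') (simp add: mk)
    also have "\<dots> = (SUP i. \<integral>\<^sup>+y. \<integral>\<^sup>+x. U i (x, y) \<partial>\<kappa> \<partial>\<nu>)" using seq.IH by simp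
    also have "\<dots> = (\<integral>\<^sup>+y. (SUP i. \<integral>\<^sup>+x. U i (x, y) \<partial>\<kappa>) \<partial>\<nu>)"
      using seq.IH by (intro nn_integral_monotone_convergence_SUP[symmetric] inc') (simp add: mn)
    finally show ?case
      unfolding ix iy using seq.IH by (intro conjI borel_measurable_SUP) auto
  qed
qed

end

subsection \<open>The unit ball of \<open>L\<^sup>1\<close> as a complete metric space\<close>

lemma L1_rep_L1_class:
  assumes "integrable \<mu> f"
  shows integrable_L1_rep_L1_class: "integrable \<mu> (L1_rep (L1_class \<mu> f))"
    and AE_L1_rep_L1_class: "AE x in \<mu>. L1_rep (L1_class \<mu> f) x = f x"
proof -
  have "f \<in> L1_class \<mu> f" using assms by (simp add: L1_class_def)
  then have "L1_rep (L1_class \<mu> f) \<in> L1_class \<mu> f"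
    unfolding L1_rep_def by (rule someI[where P="\<lambda>h. h \<in> L1_class \<mu> f"])
  then show "integrable \<mu> (L1_rep (L1_class \<mu> f))" "AE x in \<mu>. L1_rep (L1_class \<mu> f) x = f x"
    by (simp_all add: L1_class_def)
qed

lemma L1_class_cong:
  assumes "AE x in \<mu>. f x = g x"
  shows "L1_class \<mu> f = L1_class \<mu> g"
proof -
  have "(AE x in \<mu>. h x = f x) \<longleftrightarrow> (AE x in \<mu>. h x = g x)" for h
    using assms by (intro eventually_subst) (auto elim: eventually_mono)
  then show ?thesis by (simp add: L1_class_def)
qed

lemma L1_class_in_L1_space: "integrable \<mu> f \<Longrightarrow> L1_class \<mu> f \<in> L1_space \<mu>"
  by (simp add: L1_space_def)

lemma L1_spaceD:
  assumes "F \<in> L1_space \<mu>"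
  shows integrable_L1_rep: "integrable \<mu> (L1_rep F)"
    and L1_class_L1_rep: "L1_class \<mu> (L1_rep F) = F"
proof -
  obtain f where f: "integrable \<mu> f" "F = L1_class \<mu> f"
    using assms by (auto simp: L1_space_def)
  show "integrable \<mu> (L1_rep F)" "L1_class \<mu> (L1_rep F) = F"
    using L1_rep_L1_class[OF f(1)] L1_class_cong[OF AE_L1_rep_L1_class[OF f(1)]]
    unfolding f(2) by auto
qed

lemma L1_norm_L1_class:
  assumes "integrable \<mu> f"
  shows "L1_norm \<mu> (L1_class \<mu> f) = (\<integral>x. \<bar>f x\<bar> \<partial>\<mu>)"
  unfolding L1_norm_def
  using L1_rep_L1_class[OF assms] assms
  by (intro integral_cong_AE) (auto elim: eventually_mono)

lemma L1_dist_L1_class: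
  assumes "integrable \<mu> f" "integrable \<mu> g"
  shows "L1_dist \<mu> (L1_class \<mu> f) (L1_class \<mu> g) = (\<integral>x. \<bar>f x - g x\<bar> \<partial>\<mu>)"
  unfolding L1_dist_def
  using L1_rep_L1_class[OF assms(1)] L1_rep_L1_class[OF assms(2)] assms
  by (intro integral_cong_AE) (auto elim: eventually_elim2)

lemma integral_abs_triangle:
  fixes f g h :: "'a \<Rightarrow> real"
  assumes "integrable \<mu> f" "integrable \<mu> g" "integrable \<mu> h"
  shows "(\<integral>x. \<bar>f x - h x\<bar> \<partial>\<mu>) \<le> (\<integral>x. \<bar>f x - g x\<bar> \<partial>\<mu>) + (\<integral>x. \<bar>g x - h x\<bar> \<partial>\<mu>)"
proof -
  have "(\<integral>x. \<bar>f x - h x\<bar> \<partial>\<mu>) \<le> (\<integral>x. \<bar>f x - g x\<bar> + \<bar>g x - h x\<bar> \<partial>\<mu>)"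
    using assms by (intro integral_mono) auto
  also have "\<dots> = (\<integral>x. \<bar>f x - g x\<bar> \<partial>\<mu>) + (\<integral>x. \<bar>g x - h x\<bar> \<partial>\<mu>)"
    using assms by (intro Bochner_Integration.integral_add) auto
  finally show ?thesis .
qed

lemma Metric_space_L1: "Metric_space (L1_space \<mu>) (L1_dist \<mu>)"
proof
  show "0 \<le> L1_dist \<mu> F G" for F G by (simp add: L1_dist_def)
  show "L1_dist \<mu> F G = L1_dist \<mu> G F" for F G by (simp add: L1_dist_def abs_minus_commute)
next
  fix F G assume FG: "F \<in> L1_space \<mu>" "G \<in> L1_space \<mu>"
  note i = FG[THEN integrable_L1_rep]
  have "L1_dist \<mu> F G = 0 \<longleftrightarrow> (AE x in \<mu>. \<bar>L1_rep F x - L1_rep G x\<bar> = 0)"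
    unfolding L1_dist_def using i by (intro integral_nonneg_eq_0_iff_AE) auto
  also have "\<dots> \<longleftrightarrow> (AE x in \<mu>. L1_rep F x = L1_rep G x)" by simp
  also have "\<dots> \<longleftrightarrow> F = G"
    using L1_class_cong[of "L1_rep F" "L1_rep G" \<mu>] FG by (auto simp: L1_class_L1_rep)
  finally show "L1_dist \<mu> F G = 0 \<longleftrightarrow> F = G" .
next
  fix F G H assume "F \<in> L1_space \<mu>" "G \<in> L1_space \<mu>" "H \<in> L1_space \<mu>"
  from this[THEN integrable_L1_rep] show "L1_dist \<mu> F H \<le> L1_dist \<mu> F G + L1_dist \<mu> G H"
    unfolding L1_dist_def by (intro integral_abs_triangle)
qed

text \<open>The integral of the pointwise sum is the sum of the integrals, hence finite, so the
  pointwise sum is finite almost everywhere.\<close>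

lemma AE_summable_of_summable_integral:
  fixes D :: "nat \<Rightarrow> 'a \<Rightarrow> real"
  assumes D: "\<And>n. integrable \<mu> (D n)" and s: "summable (\<lambda>n. \<integral>x. \<bar>D n x\<bar> \<partial>\<mu>)"
  shows "AE x in \<mu>. summable (\<lambda>n. \<bar>D n x\<bar>)"
proof -
  have [measurable]: "D n \<in> borel_measurable \<mu>" for n using D by auto
  have "(\<integral>\<^sup>+x. (\<Sum>n. ennreal \<bar>D n x\<bar>) \<partial>\<mu>) = (\<Sum>n. \<integral>\<^sup>+x. ennreal \<bar>D n x\<bar> \<partial>\<mu>)"
    by (intro nn_integral_suminf) auto
  also have "\<dots> = (\<Sum>n. ennreal (\<integral>x. \<bar>D n x\<bar> \<partial>\<mu>))"
    using D by (intro suminf_cong nn_integral_eq_integral) auto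
  also have "\<dots> \<noteq> \<infinity>"
    using s by (simp add: suminf_ennreal2)
  finally have "AE x in \<mu>. (\<Sum>n. ennreal \<bar>D n x\<bar>) \<noteq> \<infinity>"
    by (intro nn_integral_PInf_AE) auto
  then show ?thesis
    by eventually_elim (auto intro: summable_suminf_not_top)
qed

text \<open>The Riesz-Fischer argument: along a subsequence with geometrically small steps the
  telescoping series converges absolutely almost everywhere, and dominated convergence turns this
  into convergence in mean.\<close>

lemma L1_Cauchy_subsequence_converges:
  fixes f :: "nat \<Rightarrow> 'a \<Rightarrow> real"
  assumes f: "\<And>n. integrable \<mu> (f n)"
    and Cauchy: "\<And>e. 0 < e \<Longrightarrow> \<exists>N. \<forall>m\<ge>N. \<forall>n\<ge>N. (\<integral>x. \<bar>f m x - f n x\<bar> \<partial>\<mu>) < e"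
  obtains g r where "integrable \<mu> g" "strict_mono r" "(\<lambda>k. \<integral>x. \<bar>f (r k) x - g x\<bar> \<partial>\<mu>) \<longlonglongrightarrow> 0"
proof -
  have "\<exists>N. \<forall>m\<ge>N. \<forall>n\<ge>N. (\<integral>x. \<bar>f m x - f n x\<bar> \<partial>\<mu>) < (1/2) ^ k" for k
    by (intro Cauchy) simp
  then obtain N where N: "\<And>k m n. m \<ge> N k \<Longrightarrow> n \<ge> N k \<Longrightarrow> (\<integral>x. \<bar>f m x - f n x\<bar> \<partial>\<mu>) < (1/2) ^ k"
    by metis
  \<comment> \<open>The sum makes \<open>r k\<close> at least \<open>N k\<close>; the summand
    \<open>k\<close> makes \<open>r\<close> strictly increasing.\<close>
  define r where "r k = k + (\<Sum>i\<le>k. N i)" for k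
  have r: "strict_mono r" by (simp add: strict_mono_Suc_iff r_def)
  have "N k \<le> (\<Sum>i\<le>k. N i)" for k by (intro member_le_sum) auto
  then have rN: "N k \<le> r k" for k by (simp add: r_def trans_le_add2)
  have rN': "N k \<le> r (Suc k)" for k
    using rN[of k] strict_monoD[OF r, of k "Suc k"] by simp
  define D where "D n x = f (r (Suc n)) x - f (r n) x" for n x
  have D: "integrable \<mu> (D n)" for n unfolding D_def using f by auto
  have Db: "(\<integral>x. \<bar>D n x\<bar> \<partial>\<mu>) \<le> (1/2) ^ n" for n
    unfolding D_def using N[OF rN' rN] by (simp add: less_imp_le)
  have sD: "summable (\<lambda>n. \<integral>x. \<bar>D n x\<bar> \<partial>\<mu>)"
    using Db by (intro summable_comparison_test'[OF summable_geometric[of "1/2::real"]]) auto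
  note AEs = AE_summable_of_summable_integral[OF D sD]
  define g where "g x = f (r 0) x + (\<Sum>n. D n x)" for x
  define w where "w x = (\<Sum>n. \<bar>D n x\<bar>)" for x
  have S: "integrable \<mu> (\<lambda>x. \<Sum>n. D n x)"
    using D AEs sD by (intro integrable_suminf) auto
  have g: "integrable \<mu> g" unfolding g_def using f S by auto
  have w: "integrable \<mu> w"
    unfolding w_def using D AEs sD by (intro integrable_suminf) auto
  have "(\<Sum>n<k. D n x) = f (r k) x - f (r 0) x" for k x
    unfolding D_def by (rule sum_lessThan_telescope)
  then have tel: "f (r k) x - g x = (\<Sum>n<k. D n x) - (\<Sum>n. D n x)" for k x
    by (simp add: g_def)
  have "(\<lambda>k. \<integral>x. \<bar>f (r k) x - g x\<bar> \<partial>\<mu>) \<longlonglongrightarrow> (\<integral>x. 0 \<partial>\<mu>)"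
  proof (rule integral_dominated_convergence)
    show "(\<lambda>x. 0::real) \<in> borel_measurable \<mu>" by simp
    show "(\<lambda>x. \<bar>f (r k) x - g x\<bar>) \<in> borel_measurable \<mu>" for k
      using f g by (intro borel_measurable_integrable) auto
    \<comment> \<open>Partial sums and the full sum of the \<open>D n\<close> are each bounded by
      \<open>w\<close>, hence the factor 2.\<close>
    show "integrable \<mu> (\<lambda>x. 2 * w x)" using w by simp
    show "AE x in \<mu>. (\<lambda>k. \<bar>f (r k) x - g x\<bar>) \<longlonglongrightarrow> 0"
      using AEs
    proof eventually_elim
      case (elim x)
      then have "summable (\<lambda>n. D n x)" by (rule summable_rabs_cancel)
      then have "(\<lambda>k. \<Sum>n<k. D n x) \<longlonglongrightarrow> (\<Sum>n. D n x)" by (rule summable_LIMSEQ)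
      then show ?case unfolding tel by (intro tendsto_rabs_zero LIM_zero)
    qed
    show "AE x in \<mu>. norm \<bar>f (r k) x - g x\<bar> \<le> 2 * w x" for k
      using AEs
    proof eventually_elim
      case (elim x)
      have "\<bar>\<Sum>n<k. D n x\<bar> \<le> (\<Sum>n<k. \<bar>D n x\<bar>)" by (rule sum_abs)
      also have "\<dots> \<le> w x" unfolding w_def using elim by (intro sum_le_suminf) auto
      finally have 1: "\<bar>\<Sum>n<k. D n x\<bar> \<le> w x" .
      have "\<bar>\<Sum>n. D n x\<bar> \<le> w x" unfolding w_def using elim by (rule summable_rabs)
      with 1 show ?case unfolding tel by simp
    qed
  qed
  then have "(\<lambda>k. \<integral>x. \<bar>f (r k) x - g x\<bar> \<partial>\<mu>) \<longlonglongrightarrow> 0" by simp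
  with g r show ?thesis by (rule that)
qed

definition L1_ball :: "'a measure \<Rightarrow> ('a \<Rightarrow> real) set set" where
  "L1_ball \<mu> = {F \<in> L1_space \<mu>. L1_norm \<mu> F \<le> 1}"

lemma L1_class_in_L1_ball:
  "integrable \<mu> f \<Longrightarrow> (\<integral>x. \<bar>f x\<bar> \<partial>\<mu>) \<le> 1 \<Longrightarrow> L1_class \<mu> f \<in> L1_ball \<mu>"
  by (simp add: L1_ball_def L1_class_in_L1_space L1_norm_L1_class)

lemma Metric_space_L1_ball: "Metric_space (L1_ball \<mu>) (L1_dist \<mu>)"
  by (rule Metric_space.subspace[OF Metric_space_L1]) (auto simp: L1_ball_def)

text \<open>A Cauchy sequence converges once a subsequence does. The limit stays in the ball, as its
  norm is at most 1 plus its distance to members of the ball.\<close>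

lemma mcomplete_L1_ball: "Metric_space.mcomplete (L1_ball \<mu>) (L1_dist \<mu>)"
proof -
  interpret Metric_space "L1_ball \<mu>" "L1_dist \<mu>" by (rule Metric_space_L1_ball)
  show ?thesis
    unfolding mcomplete_def
  proof (intro allI impI)
    fix \<sigma> :: "nat \<Rightarrow> ('a \<Rightarrow> real) set" assume M: "MCauchy \<sigma>"
    then have ball: "\<sigma> n \<in> L1_ball \<mu>" for n by (auto simp: MCauchy_def)
    then have sp: "\<sigma> n \<in> L1_space \<mu>" for n by (auto simp: L1_ball_def)
    define f where "f n = L1_rep (\<sigma> n)" for n
    have f: "integrable \<mu> (f n)" and cf: "L1_class \<mu> (f n) = \<sigma> n" for n
      unfolding f_def using sp by (auto simp: integrable_L1_rep L1_class_L1_rep)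
    have nf: "(\<integral>x. \<bar>f n x\<bar> \<partial>\<mu>) \<le> 1" for n
      using ball[of n] by (simp add: L1_ball_def L1_norm_def f_def)
    have "\<exists>N. \<forall>m\<ge>N. \<forall>n\<ge>N. (\<integral>x. \<bar>f m x - f n x\<bar> \<partial>\<mu>) < e" if "0 < e" for e
    proof -
      obtain N where "\<And>m n. N \<le> m \<Longrightarrow> N \<le> n \<Longrightarrow> L1_dist \<mu> (\<sigma> m) (\<sigma> n) < e"
        using M \<open>0 < e\<close> unfolding MCauchy_def by metis
      then show ?thesis unfolding L1_dist_def f_def by (intro exI[of _ N]) auto
    qed
    from L1_Cauchy_subsequence_converges[OF f this] obtain g r where
      g: "integrable \<mu> g" and r: "strict_mono r"
      and lim: "(\<lambda>k. \<integral>x. \<bar>f (r k) x - g x\<bar> \<partial>\<mu>) \<longlonglongrightarrow> 0" .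
    have "(\<integral>x. \<bar>g x\<bar> \<partial>\<mu>) \<le> 1 + 0"
    proof (rule LIMSEQ_le_const)
      show "(\<lambda>k. 1 + (\<integral>x. \<bar>f (r k) x - g x\<bar> \<partial>\<mu>)) \<longlonglongrightarrow> 1 + 0"
        by (intro tendsto_add tendsto_const lim)
      have "(\<integral>x. \<bar>g x\<bar> \<partial>\<mu>) \<le> 1 + (\<integral>x. \<bar>f (r k) x - g x\<bar> \<partial>\<mu>)" for k
        using integral_abs_triangle[OF g f[of "r k"] integrable_zero] nf[of "r k"]
        by (simp add: abs_minus_commute)
      then show "\<exists>N. \<forall>k\<ge>N. (\<integral>x. \<bar>g x\<bar> \<partial>\<mu>) \<le> 1 + (\<integral>x. \<bar>f (r k) x - g x\<bar> \<partial>\<mu>)"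
        by blast
    qed
    then have gb: "L1_class \<mu> g \<in> L1_ball \<mu>" using g by (simp add: L1_class_in_L1_ball)
    have "L1_dist \<mu> (\<sigma> n) (L1_class \<mu> g) = (\<integral>x. \<bar>f n x - g x\<bar> \<partial>\<mu>)" for n
      using L1_dist_L1_class[OF f g] by (simp add: cf)
    with lim have "limitin mtopology (\<sigma> \<circ> r) (L1_class \<mu> g) sequentially"
      using gb ball by (simp add: limitin_metric_dist_null)
    then show "\<exists>x. limitin mtopology \<sigma> x sequentially"
      using MCauchy_convergent_subsequence[OF M r] by blast
  qed
qed

subsection \<open>Haar measures without sigma-finiteness\<close>

text \<open>Haar measure is invariant under images of translations, while openness and measurability
  pass to preimages; this links the two.\<close>

lemma vimage_translate:
  fixes g :: "'a::group_add"
  shows "(\<lambda>x. g + x) -` A = (\<lambda>x. - g + x) ` A"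
proof
  show "(\<lambda>x. g + x) -` A \<subseteq> (\<lambda>x. - g + x) ` A"
    by (auto intro!: image_eqI[of _ _ "g + _"])
qed auto

lemma continuous_on_shear: "continuous_on UNIV (\<lambda>p :: 'a::topological_group_add \<times> 'a. - snd p + fst p)"
  by (intro continuous_intros)

lemma measurable_shear:
  fixes g :: "'a::topological_group_add \<Rightarrow> 'b::topological_space"
  shows "g \<in> borel_measurable borel \<Longrightarrow> (\<lambda>p. g (- snd p + fst p)) \<in> borel_measurable borel"
  by (rule measurable_compose[OF borel_measurable_continuous_onI[OF continuous_on_shear]])

locale haar_measure =
  fixes \<mu> :: "'a::{topological_group_add, t2_space} measure"
  assumes haar: "left_haar_measure \<mu>"
begin

lemma sets_mu [measurable_cong]: "sets \<mu> = sets borel"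
  using haar by (simp add: left_haar_measure_def)

lemma space_mu [simp]: "space \<mu> = UNIV"
  using sets_eq_imp_space_eq[OF sets_mu] by simp

lemma measurable_mu: "borel_measurable \<mu> = borel_measurable borel"
  by (intro measurable_cong_sets sets_mu refl)

lemma open_sets_mu [intro]: "open U \<Longrightarrow> U \<in> sets \<mu>"
  by (simp add: sets_mu)

lemma compact_sets_mu [intro]: "compact K \<Longrightarrow> K \<in> sets \<mu>"
  by (simp add: sets_mu borel_compact)

lemma emeasure_compact: "compact K \<Longrightarrow> emeasure \<mu> K < \<infinity>"
  using haar by (simp add: left_haar_measure_def)

lemma outer_regular:
  assumes "A \<in> sets borel" "emeasure \<mu> A < c"
  obtains U where "open U" "A \<subseteq> U" "emeasure \<mu> U < c"
proof -
  have "(INF U\<in>{U. open U \<and> A \<subseteq> U}. emeasure \<mu> U) < c"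
    using haar assms unfolding left_haar_measure_def by metis
  then show ?thesis using that by (auto simp: INF_less_iff)
qed

lemma emeasure_open_eq_SUP:
  "open U \<Longrightarrow> emeasure \<mu> U = (SUP K\<in>{K. compact K \<and> K \<subseteq> U}. emeasure \<mu> K)"
  using haar unfolding left_haar_measure_def by blast

lemma inner_regular:
  assumes "open U" "c < emeasure \<mu> U"
  obtains K where "compact K" "K \<subseteq> U" "c < emeasure \<mu> K"
  using assms that by (auto simp: emeasure_open_eq_SUP less_SUP_iff)

lemma emeasure_vimage_translate:
  "A \<in> sets borel \<Longrightarrow> emeasure \<mu> ((\<lambda>x. g + x) -` A) = emeasure \<mu> A"
  using haar by (simp add: left_haar_measure_def vimage_translate)

lemma measurable_translate: "(\<lambda>x. g + x) \<in> borel \<rightarrow>\<^sub>M (borel :: 'a measure)"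
  by (intro borel_measurable_continuous_onI continuous_intros)

lemma nn_integral_translate:
  assumes F: "F \<in> borel_measurable borel"
  shows "(\<integral>\<^sup>+x. F (g + x) \<partial>\<mu>) = (\<integral>\<^sup>+x. F x \<partial>\<mu>)"
proof -
  have t: "(\<lambda>x. g + x) \<in> \<mu> \<rightarrow>\<^sub>M borel"
    using measurable_translate by (simp add: measurable_cong_sets[OF sets_mu refl])
  have "distr \<mu> borel (\<lambda>x. g + x) = \<mu>"
  proof (rule measure_eqI)
    fix A assume "A \<in> sets (distr \<mu> borel (\<lambda>x. g + x))"
    then show "emeasure (distr \<mu> borel (\<lambda>x. g + x)) A = emeasure \<mu> A"
      by (simp add: emeasure_distr[OF t] emeasure_vimage_translate)
  qed (simp add: sets_mu)
  then have "(\<integral>\<^sup>+x. F x \<partial>\<mu>) = (\<integral>\<^sup>+x. F x \<partial>distr \<mu> borel (\<lambda>x. g + x))" by simp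
  also have "\<dots> = (\<integral>\<^sup>+x. F (g + x) \<partial>\<mu>)"
    using F by (intro nn_integral_distr t) simp
  finally show ?thesis by simp
qed

text \<open>If a nonempty open set were null, so would be its translates, finitely many of which
  cover any given compact set. Compact sets would then be null, and by inner regularity so would the
  whole group.\<close>

lemma emeasure_open_pos:
  assumes U: "open U" "U \<noteq> {}"
  shows "0 < emeasure \<mu> U"
proof (rule ccontr)
  assume "\<not> 0 < emeasure \<mu> U"
  then have 0: "emeasure \<mu> U = 0" by simp
  obtain u where u: "u \<in> U" using U by auto
  have K0: "emeasure \<mu> K = 0" if K: "compact K" for K
  proof -
    define T where "T g = (\<lambda>x. g + x) -` U" for g
    have oT: "open (T g)" for g
      unfolding T_def using U(1) by (intro open_vimage continuous_intros)
    have nT: "T g \<in> null_sets \<mu>" for g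
      using oT[of g] emeasure_vimage_translate[of U g] U(1) 0 by (auto simp: T_def null_sets_def)
    have "x \<in> T (u - x)" for x using u by (simp add: T_def)
    then have "K \<subseteq> (\<Union>g\<in>UNIV. T g)" by blast
    then obtain D where "finite D" "K \<subseteq> (\<Union>g\<in>D. T g)"
      using compactE_image[OF K, of UNIV T] oT by auto
    moreover have "(\<Union>g\<in>D. T g) \<in> null_sets \<mu>"
      using \<open>finite D\<close> nT by (intro null_sets_UN' countable_finite)
    ultimately have "K \<in> null_sets \<mu>"
      using K by (auto intro: null_sets_subset)
    then show ?thesis by auto
  qed
  have "emeasure \<mu> UNIV = (SUP K\<in>{K. compact K \<and> K \<subseteq> UNIV}. emeasure \<mu> K)"
    by (rule emeasure_open_eq_SUP) simp
  also have "\<dots> \<le> 0" using K0 by (intro SUP_least) simp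
  finally show False using haar by (simp add: left_haar_measure_def)
qed

text \<open>By inner regularity countably many compact sets approximate the measure of
  \<open>V \<inter> \<Union>\<U>\<close>, and each is covered by finitely many members of
  \<open>\<U>\<close>. The countable subfamily so collected has full measure there, and finiteness
  of the measure of \<open>V\<close> makes the remainder null.\<close>

lemma null_lindelof_finite_open:
  assumes V: "open V" "emeasure \<mu> V < \<infinity>" and U: "\<And>U. U \<in> \<U> \<Longrightarrow> open U"
  shows "\<exists>\<C>. \<C> \<subseteq> \<U> \<and> countable \<C> \<and> V \<inter> (\<Union>\<U> - \<Union>\<C>) \<in> null_sets \<mu>"
proof -
  define W where "W = V \<inter> \<Union>\<U>"
  have W: "open W" unfolding W_def using V U by auto
  have fW: "emeasure \<mu> W < \<infinity>"
    using emeasure_mono[of W V \<mu>] V by (auto simp: W_def intro: le_less_trans)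
  have ne: "{K. compact K \<and> K \<subseteq> W} \<noteq> {}" by (auto intro: exI[of _ "{}"])
  obtain s :: "nat \<Rightarrow> ennreal" where s: "range s \<subseteq> emeasure \<mu> ` {K. compact K \<and> K \<subseteq> W}"
      "(SUP K\<in>{K. compact K \<and> K \<subseteq> W}. emeasure \<mu> K) = (SUP n. s n)"
    using ennreal_SUP_countable_SUP[OF ne, of "emeasure \<mu>"] by blast
  have "\<forall>n. \<exists>\<F>. \<F> \<subseteq> \<U> \<and> finite \<F> \<and> s n \<le> emeasure \<mu> (W \<inter> \<Union>\<F>)"
  proof
    fix n
    obtain K where K: "compact K" "K \<subseteq> W" "s n = emeasure \<mu> K"
      using s(1) by blast
    obtain \<F> where F: "\<F> \<subseteq> \<U>" "finite \<F>" "K \<subseteq> \<Union>\<F>"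
      by (rule compactE[OF K(1), of \<U>]) (use K(2) U in \<open>auto simp: W_def\<close>)
    have "open (\<Union>\<F>)" using F U by auto
    then have "s n \<le> emeasure \<mu> (W \<inter> \<Union>\<F>)"
      unfolding K(3) using W K F by (intro emeasure_mono open_sets_mu open_Int) auto
    with F show "\<exists>\<F>. \<F> \<subseteq> \<U> \<and> finite \<F> \<and> s n \<le> emeasure \<mu> (W \<inter> \<Union>\<F>)" by blast
  qed
  from choice[OF this] obtain \<F> where
    F: "\<forall>n. \<F> n \<subseteq> \<U> \<and> finite (\<F> n) \<and> s n \<le> emeasure \<mu> (W \<inter> \<Union>(\<F> n))" ..
  define \<C> where "\<C> = (\<Union>n. \<F> n)"
  have CU: "\<C> \<subseteq> \<U>" using F by (auto simp: \<C>_def)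
  have cC: "countable \<C>" unfolding \<C>_def using F by (intro countable_UN) (auto intro: countable_finite)
  have C: "open (\<Union>\<C>)" using CU U by auto
  have "emeasure \<mu> W = (SUP n. s n)" using emeasure_open_eq_SUP[OF W] s(2) by simp
  also have "\<dots> \<le> emeasure \<mu> (W \<inter> \<Union>\<C>)"
  proof (rule SUP_least)
    fix n
    have "emeasure \<mu> (W \<inter> \<Union>(\<F> n)) \<le> emeasure \<mu> (W \<inter> \<Union>\<C>)"
      using W C by (intro emeasure_mono open_sets_mu open_Int) (auto simp: \<C>_def)
    then show "s n \<le> emeasure \<mu> (W \<inter> \<Union>\<C>)" using F order_trans by blast
  qed
  finally have le: "emeasure \<mu> W \<le> emeasure \<mu> (W \<inter> \<Union>\<C>)" .
  have WC: "W \<inter> \<Union>\<C> \<in> sets \<mu>" using W C by blast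
  have f2: "emeasure \<mu> (W \<inter> \<Union>\<C>) \<le> emeasure \<mu> W"
    using W by (intro emeasure_mono) auto
  have "emeasure \<mu> (W - (W \<inter> \<Union>\<C>)) = emeasure \<mu> W - emeasure \<mu> (W \<inter> \<Union>\<C>)"
    using W WC fW f2 by (intro emeasure_Diff) auto
  also have "\<dots> = 0" using le by (rule diff_eq_0_ennreal[rotated]) (use fW f2 in auto)
  finally have "W - (W \<inter> \<Union>\<C>) \<in> null_sets \<mu>"
    using W WC by (auto intro!: null_setsI)
  moreover have "W - (W \<inter> \<Union>\<C>) = V \<inter> (\<Union>\<U> - \<Union>\<C>)" by (auto simp: W_def)
  ultimately show ?thesis using CU cC by auto
qed

text \<open>
  The Haar measure need not be sigma-finite, nor even semifinite on Borel sets. Integrable functions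
  and their convolutions nevertheless live on sets of the following kind, and restricted to those
  the measure has the covering property needed for Tonelli's theorem.
\<close>

definition open_sigma_finite :: "'a set \<Rightarrow> bool" where
  "open_sigma_finite S \<longleftrightarrow>
     (\<exists>\<V>. countable \<V> \<and> (\<forall>V\<in>\<V>. open V \<and> emeasure \<mu> V < \<infinity>) \<and> S \<subseteq> \<Union>\<V>)"

lemma open_sigma_finite_subset:
  "open_sigma_finite T \<Longrightarrow> S \<subseteq> T \<Longrightarrow> open_sigma_finite S"
  unfolding open_sigma_finite_def by (meson order_trans)

lemma open_sigma_finite_UN:
  assumes "countable I" "\<And>i. i \<in> I \<Longrightarrow> open_sigma_finite (S i)"
  shows "open_sigma_finite (\<Union>i\<in>I. S i)"
proof -
  have "\<forall>i\<in>I. \<exists>\<V>. countable \<V> \<and> (\<forall>V\<in>\<V>. open V \<and> emeasure \<mu> V < \<infinity>) \<and> S i \<subseteq> \<Union>\<V>"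
    using assms(2) unfolding open_sigma_finite_def by blast
  from bchoice[OF this] obtain \<V> where V: "\<forall>i\<in>I. countable (\<V> i) \<and>
      (\<forall>V\<in>\<V> i. open V \<and> emeasure \<mu> V < \<infinity>) \<and> S i \<subseteq> \<Union>(\<V> i)" ..
  show ?thesis
    unfolding open_sigma_finite_def
  proof (intro exI[of _ "\<Union>i\<in>I. \<V> i"] conjI)
    show "countable (\<Union>i\<in>I. \<V> i)" using assms(1) V by (intro countable_UN) auto
    show "\<forall>V\<in>\<Union>i\<in>I. \<V> i. open V \<and> emeasure \<mu> V < \<infinity>" using V by blast
    show "(\<Union>i\<in>I. S i) \<subseteq> \<Union>(\<Union>i\<in>I. \<V> i)" using V by fastforce
  qed
qed

lemma open_sigma_finite_finite_measure:
  assumes "A \<in> sets borel" "emeasure \<mu> A < \<infinity>"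
  shows "open_sigma_finite A"
proof -
  obtain U where "open U" "A \<subseteq> U" "emeasure \<mu> U < \<infinity>"
    using outer_regular[OF assms] .
  then show ?thesis unfolding open_sigma_finite_def by (intro exI[of _ "{U}"]) auto
qed

lemma open_sigma_finite_incseq:
  assumes "open_sigma_finite S"
  obtains A :: "nat \<Rightarrow> 'a set" where "incseq A" "\<And>k. open (A k)" "\<And>k. emeasure \<mu> (A k) < \<infinity>"
    "S \<subseteq> (\<Union>k. A k)"
proof -
  obtain \<V> where V: "countable \<V>" "\<forall>V\<in>\<V>. open V \<and> emeasure \<mu> V < \<infinity>" "S \<subseteq> \<Union>\<V>"
    using assms unfolding open_sigma_finite_def by blast
  define B where "B = from_nat_into (insert {} \<V>)"
  have rB: "range B = insert {} \<V>"
    unfolding B_def using V(1) by (intro range_from_nat_into) auto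
  have B: "open (B i)" "emeasure \<mu> (B i) < \<infinity>" for i
    using V(2) rangeI[of B i] unfolding rB by auto
  show ?thesis
  proof (rule that[of "\<lambda>k. \<Union>i<k. B i"])
    show "incseq (\<lambda>k. \<Union>i<k. B i)" by (auto simp: incseq_def intro: less_le_trans)
    show "open (\<Union>i<k. B i)" for k using B by auto
    show "emeasure \<mu> (\<Union>i<k. B i) < \<infinity>" for k
    proof -
      have "emeasure \<mu> (\<Union>i<k. B i) \<le> (\<Sum>i<k. emeasure \<mu> (B i))"
        using B by (intro emeasure_subadditive_finite) auto
      also have "\<dots> < \<infinity>" using B by (simp add: ennreal_sum_less_top)
      finally show ?thesis .
    qed
    have "\<Union>\<V> \<subseteq> \<Union>(range B)" unfolding rB by auto
    also have "\<dots> \<subseteq> (\<Union>k. \<Union>i<k. B i)" by auto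
    finally show "S \<subseteq> (\<Union>k. \<Union>i<k. B i)" using V(3) by simp
  qed
qed

text \<open>The sets where the absolute value is at least 1/(n+1) exhaust the support; Markov's
  inequality makes their measure finite, and outer regularity encloses them in open sets of finite
  measure.\<close>

lemma open_sigma_finite_integrable:
  fixes f :: "'a \<Rightarrow> real"
  assumes f: "integrable \<mu> f"
  shows "open_sigma_finite {x. f x \<noteq> 0}"
proof -
  define S where "S n = {x. 1 / real (Suc n) \<le> \<bar>f x\<bar>}" for n
  have fm: "f \<in> borel_measurable borel" using borel_measurable_integrable[OF f] by (simp add: measurable_mu)
  have "open_sigma_finite (\<Union>n\<in>UNIV. S n)"
  proof (intro open_sigma_finite_UN open_sigma_finite_finite_measure)
    fix n
    show "S n \<in> sets borel" unfolding S_def using fm by measurable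
    have "emeasure \<mu> {x\<in>space \<mu>. 1 / real (Suc n) \<le> \<bar>f x\<bar>}
        \<le> ennreal (1 / (1 / real (Suc n)) * (\<integral>x. \<bar>f x\<bar> \<partial>\<mu>))"
      using f by (intro integral_Markov_inequality) auto
    also have "\<dots> < \<infinity>" by simp
    finally show "emeasure \<mu> (S n) < \<infinity>" by (simp add: S_def)
  qed simp
  moreover have "{x. f x \<noteq> 0} \<subseteq> (\<Union>n\<in>UNIV. S n)"
  proof
    fix x assume "x \<in> {x. f x \<noteq> 0}"
    then obtain n where "inverse (real (Suc n)) < \<bar>f x\<bar>"
      using reals_Archimedean[of "\<bar>f x\<bar>"] by auto
    then show "x \<in> (\<Union>n\<in>UNIV. S n)" by (auto simp: S_def inverse_eq_divide intro: less_imp_le)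
  qed
  ultimately show ?thesis by (rule open_sigma_finite_subset)
qed

text \<open>\<open>null_lindelof_finite_open\<close> serves each member of a countable open cover of
  the support; outside that cover the density vanishes.\<close>

lemma null_lindelof_density:
  assumes p: "p \<in> borel_measurable borel" and fin: "(\<integral>\<^sup>+x. p x \<partial>\<mu>) < \<infinity>"
    and osf: "open_sigma_finite {x. p x \<noteq> 0}"
  shows "null_lindelof_measure (density \<mu> p)"
proof (intro null_lindelof_measure.intro finite_measureI null_lindelof_measure_axioms.intro)
  have pm: "p \<in> borel_measurable \<mu>" using p by (simp add: measurable_mu)
  show "emeasure (density \<mu> p) (space (density \<mu> p)) \<noteq> \<infinity>"
    using fin pm by (simp add: emeasure_density)
  show "sets (density \<mu> p) = sets borel" by (simp add: sets_mu)
  fix \<U> :: "'a set set" assume U: "\<And>U. U \<in> \<U> \<Longrightarrow> open U"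
  obtain \<V> where V: "countable \<V>" "\<forall>V\<in>\<V>. open V \<and> emeasure \<mu> V < \<infinity>" "{x. p x \<noteq> 0} \<subseteq> \<Union>\<V>"
    using osf unfolding open_sigma_finite_def by blast
  have "\<forall>V\<in>\<V>. \<exists>\<C>. \<C> \<subseteq> \<U> \<and> countable \<C> \<and> V \<inter> (\<Union>\<U> - \<Union>\<C>) \<in> null_sets \<mu>"
    using V(2) U by (intro ballI null_lindelof_finite_open) auto
  from bchoice[OF this] obtain \<C> where C: "\<forall>V\<in>\<V>. \<C> V \<subseteq> \<U> \<and> countable (\<C> V) \<and>
      V \<inter> (\<Union>\<U> - \<Union>(\<C> V)) \<in> null_sets \<mu>" ..
  define \<C>' where "\<C>' = (\<Union>V\<in>\<V>. \<C> V)"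
  have C'U: "\<C>' \<subseteq> \<U>" using C by (auto simp: \<C>'_def)
  have s: "\<Union>\<U> - \<Union>\<C>' \<in> sets \<mu>"
    using C'U U by (intro sets.Diff open_sets_mu open_Union) auto
  have N: "(\<Union>V\<in>\<V>. V \<inter> (\<Union>\<U> - \<Union>(\<C> V))) \<in> null_sets \<mu>"
    using V(1) C by (intro null_sets_UN') auto
  have "AE x in \<mu>. p x * indicator (\<Union>\<U> - \<Union>\<C>') x = 0"
    using AE_not_in[OF N]
  proof eventually_elim
    case (elim x)
    show ?case
    proof (cases "x \<in> \<Union>\<U> - \<Union>\<C>'")
      case True
      have "x \<notin> \<Union>\<V>"
      proof
        assume "x \<in> \<Union>\<V>"
        then obtain V where VV: "V \<in> \<V>" "x \<in> V" by blast
        then have "\<Union>(\<C> V) \<subseteq> \<Union>\<C>'" by (auto simp: \<C>'_def)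
        with True VV elim show False by blast
      qed
      then show ?thesis using V(3) by auto
    qed simp
  qed
  then have "(\<integral>\<^sup>+x. p x * indicator (\<Union>\<U> - \<Union>\<C>') x \<partial>\<mu>) = (\<integral>\<^sup>+x. 0 \<partial>\<mu>)"
    by (rule nn_integral_cong_AE)
  then have "emeasure (density \<mu> p) (\<Union>\<U> - \<Union>\<C>') = 0"
    using s pm by (simp add: emeasure_density)
  moreover have "countable \<C>'" unfolding \<C>'_def using V(1) C by (intro countable_UN) auto
  ultimately show "\<exists>\<C>\<subseteq>\<U>. countable \<C> \<and> emeasure (density \<mu> p) (\<Union>\<U> - \<Union>\<C>) = 0"
    using C'U by blast
qed

text \<open>Restriction to \<open>A\<close> is expressed by a density so that the measure stays
  defined on all Borel sets, as the locale demands.\<close>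

lemma null_lindelof_indicator:
  assumes A: "A \<in> sets borel" "emeasure \<mu> A < \<infinity>"
  shows "null_lindelof_measure (density \<mu> (indicator A))"
proof (rule null_lindelof_density)
  show "(indicator A :: 'a \<Rightarrow> ennreal) \<in> borel_measurable borel" using A by simp
  show "(\<integral>\<^sup>+x. indicator A x \<partial>\<mu>) < \<infinity>" using A by (simp add: sets_mu)
  have "{x. indicator A x \<noteq> (0::ennreal)} = A" by (auto simp: indicator_def)
  then show "open_sigma_finite {x. indicator A x \<noteq> (0::ennreal)}"
    using open_sigma_finite_finite_measure[OF A] by simp
qed

lemma null_lindelof_integrable:
  fixes f :: "'a \<Rightarrow> real"
  assumes f: "integrable \<mu> f"
  shows "null_lindelof_measure (density \<mu> (\<lambda>x. ennreal \<bar>f x\<bar>))"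
proof (rule null_lindelof_density)
  have [measurable]: "f \<in> borel_measurable borel"
    using borel_measurable_integrable[OF f] by (simp add: measurable_mu)
  show "(\<lambda>x. ennreal \<bar>f x\<bar>) \<in> borel_measurable borel" by measurable
  show "(\<integral>\<^sup>+x. ennreal \<bar>f x\<bar> \<partial>\<mu>) < \<infinity>"
    using f by (simp add: nn_integral_eq_integral)
  show "open_sigma_finite {x. ennreal \<bar>f x\<bar> \<noteq> 0}"
    using open_sigma_finite_integrable[OF f] by (simp add: ennreal_eq_0_iff)
qed

text \<open>
  The function \<open>x \<mapsto> \<mu> (V \<inter> (x - V'))\<close> is lower semicontinuous and positive exactly on the sum set, and
  Tonelli's theorem over compact sets bounds the measure of the open sets where it exceeds \<open>1 / k\<close>.
\<close>

lemma open_sigma_finite_sum: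
  assumes V: "open V" "emeasure \<mu> V < \<infinity>" and V': "open V'" "emeasure \<mu> V' < \<infinity>"
  shows "open_sigma_finite {x. \<exists>y\<in>V. - y + x \<in> V'}"
proof -
  \<comment> \<open>The first coordinate is the candidate sum \<open>x\<close>, the second its left
    summand \<open>y\<close>.\<close>
  define W where "W = snd -` V \<inter> (\<lambda>p :: 'a \<times> 'a. - snd p + fst p) -` V'"
  have W: "open W"
    unfolding W_def using V V' by (intro open_Int open_vimage continuous_on_shear continuous_intros)
  define \<nu> where "\<nu> = density \<mu> (indicator V)"
  interpret \<nu>: null_lindelof_measure \<nu>
    unfolding \<nu>_def using V by (intro null_lindelof_indicator) auto
  define R where "R k = {x. 1 / real (Suc k) < measure \<nu> (Pair x -` W)}" for k
  have oR: "open (R k)" for k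
    unfolding R_def by (rule \<nu>.open_measure_section_gt[OF W])
  \<comment> \<open>The measure of \<open>R k\<close> might a priori be infinite, so Tonelli's
    theorem is applied over its compact subsets; inner regularity then transfers the bound to
    \<open>R k\<close>.\<close>
  have K: "emeasure \<mu> K \<le> ennreal (real (Suc k)) * (emeasure \<mu> V' * emeasure \<mu> V)"
    if K: "compact K" "K \<subseteq> R k" for K k
  proof -
    define \<kappa> where "\<kappa> = density \<mu> (indicator K)"
    interpret \<kappa>: null_lindelof_measure \<kappa>
      unfolding \<kappa>_def using K
      by (intro null_lindelof_indicator emeasure_compact borel_compact)
    interpret null_lindelof_pair \<kappa> \<nu> ..
    have Kb: "K \<in> sets \<mu>" using K by auto
    have eK: "emeasure \<kappa> A \<le> emeasure \<mu> A" if "A \<in> sets \<mu>" for A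
      unfolding \<kappa>_def using that Kb
      by (auto simp: emeasure_restricted intro!: emeasure_mono)
    have "ennreal (1 / real (Suc k)) * emeasure \<mu> K = (\<integral>\<^sup>+x. ennreal (1 / real (Suc k)) * indicator K x \<partial>\<mu>)"
      using Kb by (simp add: nn_integral_cmult_indicator)
    also have "\<dots> \<le> (\<integral>\<^sup>+x. indicator K x * emeasure \<nu> (Pair x -` W) \<partial>\<mu>)"
      using K(2) by (intro nn_integral_mono)
        (auto simp: R_def \<nu>.emeasure_eq_measure indicator_def intro!: ennreal_leI less_imp_le)
    also have "\<dots> = (\<integral>\<^sup>+x. emeasure \<nu> (Pair x -` W) \<partial>\<kappa>)"
      unfolding \<kappa>_def using Kb section_integral_open(1)[OF W]
      by (intro nn_integral_density[symmetric]) (auto simp: measurable_mu)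
    also have "\<dots> = (\<integral>\<^sup>+y. emeasure \<kappa> ((\<lambda>x. (x, y)) -` W) \<partial>\<nu>)"
      by (rule section_integral_open(3)[OF W])
    also have "\<dots> \<le> (\<integral>\<^sup>+y. emeasure \<mu> V' \<partial>\<nu>)"
    proof (rule nn_integral_mono)
      fix y
      have "(\<lambda>x. (x, y)) -` W \<in> sets \<kappa>"
        using W by (intro \<kappa>.section_borel') auto
      then have "emeasure \<kappa> ((\<lambda>x. (x, y)) -` W) \<le> emeasure \<mu> ((\<lambda>x. (x, y)) -` W)"
        by (intro eK) (simp add: \<kappa>_def)
      \<comment> \<open>For fixed \<open>y\<close> the section lies in the left translate of
        \<open>V'\<close> by \<open>y\<close>.\<close>
      also have "\<dots> \<le> emeasure \<mu> ((\<lambda>x. - y + x) -` V')"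
        using V'(1)
        by (intro emeasure_mono open_sets_mu open_vimage continuous_intros) (auto simp: W_def)
      also have "\<dots> = emeasure \<mu> V'"
        using V' by (intro emeasure_vimage_translate) auto
      finally show "emeasure \<kappa> ((\<lambda>x. (x, y)) -` W) \<le> emeasure \<mu> V'" .
    qed
    also have "\<dots> = emeasure \<mu> V' * emeasure \<mu> V"
      using emeasure_restricted[OF open_sets_mu[OF V(1)], of UNIV] by (simp add: \<nu>_def sets_mu)
    finally have *: "ennreal (1 / real (Suc k)) * emeasure \<mu> K \<le> emeasure \<mu> V' * emeasure \<mu> V" .
    have "ennreal (real (Suc k)) * ennreal (1 / real (Suc k)) = ennreal (real (Suc k) * (1 / real (Suc k)))"
      by (rule ennreal_mult[symmetric]) auto
    then have "ennreal (real (Suc k)) * ennreal (1 / real (Suc k)) = 1" by simp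
    then have "emeasure \<mu> K = ennreal (real (Suc k)) * (ennreal (1 / real (Suc k)) * emeasure \<mu> K)"
      by (simp flip: mult.assoc)
    also have "\<dots> \<le> ennreal (real (Suc k)) * (emeasure \<mu> V' * emeasure \<mu> V)"
      using * by (rule mult_left_mono) simp
    finally show ?thesis .
  qed
  have fR: "emeasure \<mu> (R k) < \<infinity>" for k
  proof -
    have "emeasure \<mu> (R k) \<le> ennreal (real (Suc k)) * (emeasure \<mu> V' * emeasure \<mu> V)"
      unfolding emeasure_open_eq_SUP[OF oR] using K by (intro SUP_least) auto
    also have "\<dots> < \<infinity>" using V V' by (simp add: ennreal_mult_less_top)
    finally show ?thesis .
  qed
  have "{x. \<exists>y\<in>V. - y + x \<in> V'} \<subseteq> (\<Union>k. R k)"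
  proof
    fix x assume "x \<in> {x. \<exists>y\<in>V. - y + x \<in> V'}"
    then have ne: "Pair x -` W \<noteq> {}" by (auto simp: W_def)
    have o: "open (Pair x -` W)" by (rule open_Pair_vimage[OF W])
    have "emeasure \<nu> (Pair x -` W) = emeasure \<mu> (V \<inter> Pair x -` W)"
      unfolding \<nu>_def using V o by (intro emeasure_restricted open_sets_mu)
    also have "V \<inter> Pair x -` W = Pair x -` W" by (auto simp: W_def)
    \<comment> \<open>The section is open and nonempty, so its Haar measure is positive and exceeds
      one of the thresholds.\<close>
    finally have "0 < ennreal (measure \<nu> (Pair x -` W))"
      using emeasure_open_pos[OF o ne] by (simp only: \<nu>.emeasure_eq_measure)
    then have "0 < measure \<nu> (Pair x -` W)" by simp
    then obtain k where "inverse (real (Suc k)) < measure \<nu> (Pair x -` W)"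
      using reals_Archimedean by blast
    then show "x \<in> (\<Union>k. R k)" by (auto simp: R_def inverse_eq_divide)
  qed
  then show ?thesis
    unfolding open_sigma_finite_def using oR fR by (intro exI[of _ "range R"]) auto
qed

lemma open_sigma_finite_convolution_support:
  fixes f g :: "'a \<Rightarrow> real"
  assumes "integrable \<mu> f" "integrable \<mu> g"
  shows "open_sigma_finite {x. \<exists>y. f y \<noteq> 0 \<and> g (- y + x) \<noteq> 0}"
proof -
  obtain \<V> where V: "countable \<V>" "\<forall>V\<in>\<V>. open V \<and> emeasure \<mu> V < \<infinity>" "{x. f x \<noteq> 0} \<subseteq> \<Union>\<V>"
    using open_sigma_finite_integrable[OF assms(1)] unfolding open_sigma_finite_def by blast
  obtain \<V>' where V': "countable \<V>'" "\<forall>V\<in>\<V>'. open V \<and> emeasure \<mu> V < \<infinity>" "{x. g x \<noteq> 0} \<subseteq> \<Union>\<V>'"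
    using open_sigma_finite_integrable[OF assms(2)] unfolding open_sigma_finite_def by blast
  have "open_sigma_finite {x. \<exists>y\<in>V. - y + x \<in> V'}" if "V \<in> \<V>" "V' \<in> \<V>'" for V V'
    using V(2) V'(2) that by (intro open_sigma_finite_sum) auto
  then have "open_sigma_finite (\<Union>V\<in>\<V>. \<Union>V'\<in>\<V>'. {x. \<exists>y\<in>V. - y + x \<in> V'})"
    by (intro open_sigma_finite_UN V(1) V'(1))
  moreover have "{x. \<exists>y. f y \<noteq> 0 \<and> g (- y + x) \<noteq> 0} \<subseteq> (\<Union>V\<in>\<V>. \<Union>V'\<in>\<V>'. {x. \<exists>y\<in>V. - y + x \<in> V'})"
  proof
    fix x assume "x \<in> {x. \<exists>y. f y \<noteq> 0 \<and> g (- y + x) \<noteq> 0}"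
    then obtain y where "y \<in> {x. f x \<noteq> 0}" "- y + x \<in> {x. g x \<noteq> 0}" by auto
    then have "y \<in> \<Union>\<V>" "- y + x \<in> \<Union>\<V>'" using V(3) V'(3) by auto
    then show "x \<in> (\<Union>V\<in>\<V>. \<Union>V'\<in>\<V>'. {x. \<exists>y\<in>V. - y + x \<in> V'})" by auto
  qed
  ultimately show ?thesis by (rule open_sigma_finite_subset)
qed

end

subsection \<open>Convolution\<close>

context haar_measure
begin

lemma borel_measurable_integrable_mu: "integrable \<mu> f \<Longrightarrow> f \<in> borel_measurable borel"
  using borel_measurable_integrable[of \<mu> f] by (simp add: measurable_mu)

lemma measurable_shear_section:
  "g \<in> borel_measurable borel \<Longrightarrow> (\<lambda>y. g (- y + x)) \<in> borel_measurable \<mu>"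
  using measurable_compose[OF measurable_Pair_right_borel measurable_shear, of g x]
  by (simp add: measurable_mu)

lemma measurable_weighted_section_integral:
  fixes f :: "'a \<Rightarrow> real" and H :: "'a \<times> 'a \<Rightarrow> ennreal"
  assumes f: "integrable \<mu> f" and H: "H \<in> borel_measurable borel"
  shows "(\<lambda>x. \<integral>\<^sup>+y. ennreal \<bar>f y\<bar> * H (x, y) \<partial>\<mu>) \<in> borel_measurable borel"
proof -
  define \<nu> where "\<nu> = density \<mu> (\<lambda>x. ennreal \<bar>f x\<bar>)"
  interpret \<nu>: null_lindelof_measure \<nu> unfolding \<nu>_def by (rule null_lindelof_integrable[OF f])
  \<comment> \<open>What is wanted from \<open>tonelli_borel\<close> is measurability of an inner
    integral over the second factor; any measure of this kind may stand in the first place.\<close>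
  interpret null_lindelof_pair \<nu> \<nu> ..
  have "(\<integral>\<^sup>+y. H (x, y) \<partial>\<nu>) = (\<integral>\<^sup>+y. ennreal \<bar>f y\<bar> * H (x, y) \<partial>\<mu>)" for x
    unfolding \<nu>_def using f measurable_compose[OF measurable_Pair_right_borel H, of x]
    by (intro nn_integral_density) (auto simp: measurable_mu)
  with tonelli_borel[OF H] show ?thesis by simp
qed

text \<open>Exchange the integrals and apply left invariance to the inner one. The outer integral is
  truncated to open sets \<open>A k\<close> of finite measure that exhaust the set where the inner
  integral can be nonzero, and monotone convergence removes the truncation.\<close>

lemma nn_integral_convolution:
  fixes f g :: "'a \<Rightarrow> real"
  assumes f: "integrable \<mu> f" and g: "integrable \<mu> g"
  shows "(\<integral>\<^sup>+x. \<integral>\<^sup>+y. ennreal \<bar>f y * g (- y + x)\<bar> \<partial>\<mu> \<partial>\<mu>)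
    = ennreal ((\<integral>x. \<bar>f x\<bar> \<partial>\<mu>) * (\<integral>x. \<bar>g x\<bar> \<partial>\<mu>))"
proof -
  note gm = borel_measurable_integrable_mu[OF g]
  obtain A :: "nat \<Rightarrow> 'a set" where A: "incseq A" "\<And>k. open (A k)" "\<And>k. emeasure \<mu> (A k) < \<infinity>"
      "{x. \<exists>y. f y \<noteq> 0 \<and> g (- y + x) \<noteq> 0} \<subseteq> (\<Union>k. A k)"
    using open_sigma_finite_incseq[OF open_sigma_finite_convolution_support[OF f g]] by blast
  have Am [measurable]: "A k \<in> sets \<mu>" for k using A(2) by blast
  define G where "G p = ennreal \<bar>g (- snd p + fst p)\<bar>" for p
  have G: "G \<in> borel_measurable borel"
    unfolding G_def using gm by (intro measurable_shear[where g="\<lambda>z. ennreal \<bar>g z\<bar>"]) simp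
  define \<nu> where "\<nu> = density \<mu> (\<lambda>x. ennreal \<bar>f x\<bar>)"
  define \<kappa> where "\<kappa> k = density \<mu> (indicator (A k))" for k
  interpret \<nu>: null_lindelof_measure \<nu> unfolding \<nu>_def by (rule null_lindelof_integrable[OF f])
  have \<kappa>: "null_lindelof_measure (\<kappa> k)" for k
    unfolding \<kappa>_def using A by (intro null_lindelof_indicator) auto
  define h where "h x = (\<integral>\<^sup>+y. G (x, y) \<partial>\<nu>)" for x
  have Gx: "(\<lambda>y. G (x, y)) \<in> borel_measurable \<mu>" for x
    using measurable_compose[OF measurable_Pair_right_borel G] by (simp add: measurable_mu)
  have Gy: "(\<lambda>x. G (x, y)) \<in> borel_measurable \<mu>" for y
    using measurable_compose[OF measurable_Pair_left_borel G] by (simp add: measurable_mu)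
  have h: "h x = (\<integral>\<^sup>+y. ennreal \<bar>f y * g (- y + x)\<bar> \<partial>\<mu>)" for x
  proof -
    have "h x = (\<integral>\<^sup>+y. ennreal \<bar>f y\<bar> * G (x, y) \<partial>\<mu>)"
      unfolding h_def \<nu>_def using f Gx by (intro nn_integral_density) auto
    then show ?thesis by (simp add: G_def abs_mult ennreal_mult)
  qed
  have hm: "h \<in> borel_measurable \<mu>"
    using measurable_weighted_section_integral[OF f G]
    by (simp add: h[abs_def] G_def abs_mult ennreal_mult measurable_mu)
  define J where "J k y = (\<integral>\<^sup>+x. indicator (A k) x * G (x, y) \<partial>\<mu>)" for k y
  have J: "J k y = (\<integral>\<^sup>+x. G (x, y) \<partial>\<kappa> k)" for k y
    unfolding J_def \<kappa>_def using Gy by (intro nn_integral_density[symmetric]) auto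
  have ind_SUP: "(SUP k. indicator (A k) x * c) = indicator (\<Union>k. A k) x * c" for x and c :: ennreal
  proof (cases "x \<in> (\<Union>k. A k)")
    case True
    then obtain k where "x \<in> A k" by blast
    then have "c \<le> (SUP k. indicator (A k) x * c)" by (intro SUP_upper2[of k]) auto
    moreover have "(SUP k. indicator (A k) x * c) \<le> c" by (intro SUP_least) (simp add: indicator_def)
    ultimately show ?thesis using True by simp
  qed auto
  have inc: "incseq (\<lambda>k x. indicator (A k) x * c x)" for c :: "'a \<Rightarrow> ennreal"
    using A(1) by (auto simp: incseq_def le_fun_def indicator_def)
  have tonelli: "J k \<in> borel_measurable borel \<and> (\<integral>\<^sup>+x. h x \<partial>\<kappa> k) = (\<integral>\<^sup>+y. J k y \<partial>\<nu>)" for k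
  proof -
    interpret \<kappa>: null_lindelof_measure "\<kappa> k" by (rule \<kappa>)
    interpret null_lindelof_pair "\<kappa> k" \<nu> ..
    show ?thesis using tonelli_borel[OF G] by (simp add: J[abs_def] h_def)
  qed
  have "(\<integral>\<^sup>+x. h x \<partial>\<mu>) = (\<integral>\<^sup>+x. (SUP k. indicator (A k) x * h x) \<partial>\<mu>)"
  proof (rule nn_integral_cong)
    fix x
    have "h x = 0" if "x \<notin> (\<Union>k. A k)"
    proof -
      have "f y * g (- y + x) = 0" for y using that A(4) by auto
      then show ?thesis
        unfolding h by (simp only: abs_zero ennreal_0 nn_integral_const mult_zero_left)
    qed
    then show "h x = (SUP k. indicator (A k) x * h x)"
      unfolding ind_SUP by (cases "x \<in> (\<Union>k. A k)") auto
  qed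
  also have "\<dots> = (SUP k. \<integral>\<^sup>+x. indicator (A k) x * h x \<partial>\<mu>)"
    using hm by (intro nn_integral_monotone_convergence_SUP inc) auto
  also have "\<dots> = (SUP k. \<integral>\<^sup>+x. h x \<partial>\<kappa> k)"
    unfolding \<kappa>_def using hm by (intro SUP_cong refl nn_integral_density[symmetric]) auto
  also have "\<dots> = (SUP k. \<integral>\<^sup>+y. J k y \<partial>\<nu>)"
    using tonelli by simp
  also have "\<dots> = (\<integral>\<^sup>+y. (SUP k. J k y) \<partial>\<nu>)"
  proof (rule nn_integral_monotone_convergence_SUP[symmetric])
    show "incseq J"
    proof (intro monoI le_funI)
      fix m n :: nat and y :: 'a
      assume "m \<le> n"
      from incseqD[OF inc this] show "J m y \<le> J n y"
        unfolding J_def by (intro nn_integral_mono) (rule le_funD)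
    qed
    show "J k \<in> borel_measurable \<nu>" for k
      using tonelli by (simp add: \<nu>_def measurable_mu)
  qed
  also have "\<dots> = (\<integral>\<^sup>+y. ennreal \<bar>f y\<bar> * (SUP k. J k y) \<partial>\<mu>)"
    unfolding \<nu>_def using f tonelli
    by (intro nn_integral_density borel_measurable_SUP) (auto simp: measurable_mu)
  also have "\<dots> = (\<integral>\<^sup>+y. ennreal \<bar>f y\<bar> * ennreal (\<integral>x. \<bar>g x\<bar> \<partial>\<mu>) \<partial>\<mu>)"
  proof (rule nn_integral_cong)
    fix y
    \<comment> \<open>For \<open>f y\<close> nonzero the sets \<open>A k\<close> cover every
      \<open>x\<close> with \<open>g (- y + x)\<close> nonzero, so the truncation disappears in the
      supremum; for \<open>f y = 0\<close> the weight vanishes.\<close>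
    have "(SUP k. J k y) = ennreal (\<integral>x. \<bar>g x\<bar> \<partial>\<mu>)" if "f y \<noteq> 0"
    proof -
      have "(SUP k. J k y) = (\<integral>\<^sup>+x. (SUP k. indicator (A k) x * G (x, y)) \<partial>\<mu>)"
        unfolding J_def using Gy
        by (intro nn_integral_monotone_convergence_SUP[symmetric] inc) auto
      also have "\<dots> = (\<integral>\<^sup>+x. G (x, y) \<partial>\<mu>)"
      proof (rule nn_integral_cong)
        fix x
        have "G (x, y) = 0" if "x \<notin> (\<Union>k. A k)"
          using that A(4) \<open>f y \<noteq> 0\<close> by (auto simp: G_def)
        then show "(SUP k. indicator (A k) x * G (x, y)) = G (x, y)"
          unfolding ind_SUP by (cases "x \<in> (\<Union>k. A k)") auto
      qed
      also have "\<dots> = (\<integral>\<^sup>+x. ennreal \<bar>g x\<bar> \<partial>\<mu>)"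
        unfolding G_def using gm by (simp add: nn_integral_translate[of "\<lambda>z. ennreal \<bar>g z\<bar>" "- y"])
      also have "\<dots> = ennreal (\<integral>x. \<bar>g x\<bar> \<partial>\<mu>)"
        using g by (intro nn_integral_eq_integral) auto
      finally show ?thesis .
    qed
    then show "ennreal \<bar>f y\<bar> * (SUP k. J k y) = ennreal \<bar>f y\<bar> * ennreal (\<integral>x. \<bar>g x\<bar> \<partial>\<mu>)"
      by (cases "f y = 0") auto
  qed
  also have "\<dots> = (\<integral>\<^sup>+y. ennreal \<bar>f y\<bar> \<partial>\<mu>) * ennreal (\<integral>x. \<bar>g x\<bar> \<partial>\<mu>)"
    using f by (intro nn_integral_multc) auto
  also have "\<dots> = ennreal ((\<integral>x. \<bar>f x\<bar> \<partial>\<mu>) * (\<integral>x. \<bar>g x\<bar> \<partial>\<mu>))"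
    using f by (simp add: nn_integral_eq_integral ennreal_mult)
  finally show ?thesis unfolding h .
qed

lemma measurable_convolution_integrand:
  fixes f g :: "'a \<Rightarrow> real"
  assumes "integrable \<mu> f" "integrable \<mu> g"
  shows "(\<lambda>y. f y * g (- y + x)) \<in> borel_measurable \<mu>"
  using assms(1) measurable_shear_section[OF borel_measurable_integrable_mu[OF assms(2)]]
  by (intro borel_measurable_times) auto

lemma AE_integrable_convolution:
  fixes f g :: "'a \<Rightarrow> real"
  assumes f: "integrable \<mu> f" and g: "integrable \<mu> g"
  shows "AE x in \<mu>. integrable \<mu> (\<lambda>y. f y * g (- y + x))"
proof -
  have m: "(\<lambda>x. \<integral>\<^sup>+y. ennreal \<bar>f y * g (- y + x)\<bar> \<partial>\<mu>) \<in> borel_measurable \<mu>"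
    using measurable_weighted_section_integral[OF f
        measurable_shear[where g="\<lambda>z. ennreal \<bar>g z\<bar>"]] borel_measurable_integrable_mu[OF g]
    by (simp add: abs_mult ennreal_mult measurable_mu)
  have "AE x in \<mu>. (\<integral>\<^sup>+y. ennreal \<bar>f y * g (- y + x)\<bar> \<partial>\<mu>) \<noteq> \<infinity>"
    using nn_integral_convolution[OF f g] by (intro nn_integral_PInf_AE m) simp
  then show ?thesis
  proof eventually_elim
    case (elim x)
    then show ?case
      using measurable_convolution_integrand[OF f g, of x]
      by (intro integrableI_bounded) (auto simp: less_top)
  qed
qed

text \<open>The Bochner integral is the difference of the integrals of the positive and the negative
  part, and each of these is an integral weighted by the absolute value of \<open>f\<close>.\<close>

lemma measurable_convolution:
  fixes f g :: "'a \<Rightarrow> real"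
  assumes f: "integrable \<mu> f" and g: "integrable \<mu> g"
  shows "group_convolution \<mu> f g \<in> borel_measurable borel"
proof -
  note fm = borel_measurable_integrable_mu[OF f] and gm = borel_measurable_integrable_mu[OF g]
  \<comment> \<open>Since \<open>ennreal\<close> sends negative reals to 0, \<open>P 1\<close> and
    \<open>P (-1)\<close> integrate the positive and the negative part.\<close>
  define P where "P s x = (\<integral>\<^sup>+y. ennreal (s * (f y * g (- y + x))) \<partial>\<mu>)" for s x
  have Pm: "P s \<in> borel_measurable borel" for s
  proof -
    \<comment> \<open>The sign of \<open>f\<close> moves to the other factor, leaving the absolute
      value of \<open>f\<close> as the weight.\<close>
    have fs: "(\<lambda>p :: 'a \<times> 'a. s * sgn (f (snd p))) \<in> borel_measurable borel"
      using measurable_compose[OF borel_measurable_continuous_onI[OF continuous_on_snd[OF continuous_on_id]] fm]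
      by measurable
    have "(\<lambda>x. \<integral>\<^sup>+y. ennreal \<bar>f y\<bar> * ennreal (s * sgn (f y) * g (- y + x)) \<partial>\<mu>) \<in> borel_measurable borel"
      using measurable_weighted_section_integral[OF f, of
          "\<lambda>p. ennreal (s * sgn (f (snd p)) * g (- snd p + fst p))"] fs measurable_shear[OF gm]
      by simp
    moreover have "ennreal \<bar>f y\<bar> * ennreal (s * sgn (f y) * g (- y + x))
        = ennreal (s * (f y * g (- y + x)))" for x y
    proof -
      have "ennreal \<bar>f y\<bar> * ennreal (s * sgn (f y) * g (- y + x))
          = ennreal (\<bar>f y\<bar> * (s * sgn (f y) * g (- y + x)))"
        by (simp add: ennreal_mult')
      also have "\<bar>f y\<bar> * (s * sgn (f y) * g (- y + x)) = s * ((sgn (f y) * \<bar>f y\<bar>) * g (- y + x))"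
        by (simp add: algebra_simps)
      finally show ?thesis by (simp add: sgn_mult_abs)
    qed
    ultimately show ?thesis unfolding P_def[abs_def] by simp
  qed
  \<comment> \<open>The \<open>else\<close> branch matches the default value 0 of the Bochner
    integral of a function that is not integrable.\<close>
  have eq: "group_convolution \<mu> f g x
      = (if P 1 x \<noteq> \<infinity> \<and> P (-1) x \<noteq> \<infinity> then enn2real (P 1 x) - enn2real (P (-1) x) else 0)" for x
  proof -
    have i: "integrable \<mu> (\<lambda>y. f y * g (- y + x)) \<longleftrightarrow> P 1 x \<noteq> \<infinity> \<and> P (-1) x \<noteq> \<infinity>"
      using measurable_convolution_integrand[OF f g, of x] by (simp add: real_integrable_def P_def)
    show ?thesis
    proof (cases "integrable \<mu> (\<lambda>y. f y * g (- y + x))")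
      case True
      with i show ?thesis
        unfolding group_convolution_def by (simp add: real_lebesgue_integral_def P_def)
    next
      case False
      with i show ?thesis
        unfolding group_convolution_def by (auto simp: not_integrable_integral_eq)
    qed
  qed
  show ?thesis
    unfolding eq[abs_def] using Pm[of 1] Pm[of "-1"] by measurable
qed

text \<open>The pointwise bound holds at every \<open>x\<close>, the convolution being 0 by
  convention where its integrand is not integrable.\<close>

lemma nn_integral_abs_convolution_le:
  fixes f g :: "'a \<Rightarrow> real"
  assumes f: "integrable \<mu> f" and g: "integrable \<mu> g"
  shows "(\<integral>\<^sup>+x. ennreal \<bar>group_convolution \<mu> f g x\<bar> \<partial>\<mu>)
    \<le> ennreal ((\<integral>x. \<bar>f x\<bar> \<partial>\<mu>) * (\<integral>x. \<bar>g x\<bar> \<partial>\<mu>))"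
  unfolding nn_integral_convolution[OF f g, symmetric]
proof (rule nn_integral_mono)
  fix x
  show "ennreal \<bar>group_convolution \<mu> f g x\<bar> \<le> (\<integral>\<^sup>+y. ennreal \<bar>f y * g (- y + x)\<bar> \<partial>\<mu>)"
  proof (cases "integrable \<mu> (\<lambda>y. f y * g (- y + x))")
    case True
    then show ?thesis
      using integral_norm_bound_ennreal[OF True] by (simp add: group_convolution_def)
  qed (simp add: group_convolution_def not_integrable_integral_eq)
qed

lemma integrable_convolution:
  fixes f g :: "'a \<Rightarrow> real"
  assumes f: "integrable \<mu> f" and g: "integrable \<mu> g"
  shows "integrable \<mu> (group_convolution \<mu> f g)"
  using measurable_convolution[OF f g] nn_integral_abs_convolution_le[OF f g]
  by (intro integrableI_bounded) (auto simp: measurable_mu intro: le_less_trans)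

lemma integral_abs_convolution_le:
  fixes f g :: "'a \<Rightarrow> real"
  assumes f: "integrable \<mu> f" and g: "integrable \<mu> g"
  shows "(\<integral>x. \<bar>group_convolution \<mu> f g x\<bar> \<partial>\<mu>) \<le> (\<integral>x. \<bar>f x\<bar> \<partial>\<mu>) * (\<integral>x. \<bar>g x\<bar> \<partial>\<mu>)"
  using nn_integral_abs_convolution_le[OF f g] integrable_convolution[OF f g]
  by (simp add: nn_integral_eq_integral)

text \<open>This makes the convolution of two probability densities a probability density.\<close>

lemma integral_convolution_nonneg:
  fixes f g :: "'a \<Rightarrow> real"
  assumes f: "integrable \<mu> f" and g: "integrable \<mu> g" and nonneg: "\<And>x. 0 \<le> f x" "\<And>x. 0 \<le> g x"
  shows "(\<integral>x. group_convolution \<mu> f g x \<partial>\<mu>) = (\<integral>x. f x \<partial>\<mu>) * (\<integral>x. g x \<partial>\<mu>)"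
proof -
  have c0: "0 \<le> group_convolution \<mu> f g x" for x
    unfolding group_convolution_def using nonneg by simp
  have "ennreal (\<integral>x. group_convolution \<mu> f g x \<partial>\<mu>) = (\<integral>\<^sup>+x. ennreal (group_convolution \<mu> f g x) \<partial>\<mu>)"
    using integrable_convolution[OF f g] c0 by (intro nn_integral_eq_integral[symmetric]) auto
  also have "\<dots> = (\<integral>\<^sup>+x. \<integral>\<^sup>+y. ennreal \<bar>f y * g (- y + x)\<bar> \<partial>\<mu> \<partial>\<mu>)"
  proof (rule nn_integral_cong_AE)
    show "AE x in \<mu>. ennreal (group_convolution \<mu> f g x) = (\<integral>\<^sup>+y. ennreal \<bar>f y * g (- y + x)\<bar> \<partial>\<mu>)"
      using AE_integrable_convolution[OF f g]
    proof eventually_elim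
      case (elim x)
      then show ?case
        unfolding group_convolution_def using nonneg
        by (subst nn_integral_eq_integral[symmetric]) auto
    qed
  qed
  also have "\<dots> = ennreal ((\<integral>x. f x \<partial>\<mu>) * (\<integral>x. g x \<partial>\<mu>))"
    using nn_integral_convolution[OF f g] nonneg by simp
  finally show ?thesis using c0 nonneg by simp
qed

text \<open>Write the difference as (f - f') convolved with g plus f' convolved with (g - g'). The
  identity holds only almost everywhere, namely where the three integrands are integrable.\<close>

lemma convolution_lipschitz:
  fixes f g f' g' :: "'a \<Rightarrow> real"
  assumes f: "integrable \<mu> f" and g: "integrable \<mu> g" and f': "integrable \<mu> f'" and g': "integrable \<mu> g'"
  shows "(\<integral>x. \<bar>group_convolution \<mu> f g x - group_convolution \<mu> f' g' x\<bar> \<partial>\<mu>)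
    \<le> (\<integral>x. \<bar>f x - f' x\<bar> \<partial>\<mu>) * (\<integral>x. \<bar>g x\<bar> \<partial>\<mu>) + (\<integral>x. \<bar>f' x\<bar> \<partial>\<mu>) * (\<integral>x. \<bar>g x - g' x\<bar> \<partial>\<mu>)"
proof -
  define df where "df x = f x - f' x" for x
  define dg where "dg x = g x - g' x" for x
  have df: "integrable \<mu> df" and dg: "integrable \<mu> dg"
    unfolding df_def dg_def using assms by auto
  have "AE x in \<mu>. \<bar>group_convolution \<mu> f g x - group_convolution \<mu> f' g' x\<bar>
      \<le> \<bar>group_convolution \<mu> df g x\<bar> + \<bar>group_convolution \<mu> f' dg x\<bar>"
    using AE_integrable_convolution[OF f g] AE_integrable_convolution[OF f' g]
      AE_integrable_convolution[OF f' g']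
  proof eventually_elim
    case (elim x)
    have "group_convolution \<mu> df g x = group_convolution \<mu> f g x - group_convolution \<mu> f' g x"
      unfolding group_convolution_def df_def left_diff_distrib
      by (rule Bochner_Integration.integral_diff[OF elim(1,2)])
    moreover have "group_convolution \<mu> f' dg x = group_convolution \<mu> f' g x - group_convolution \<mu> f' g' x"
      unfolding group_convolution_def dg_def right_diff_distrib
      by (rule Bochner_Integration.integral_diff[OF elim(2,3)])
    ultimately show ?case by simp
  qed
  then have "(\<integral>x. \<bar>group_convolution \<mu> f g x - group_convolution \<mu> f' g' x\<bar> \<partial>\<mu>)
      \<le> (\<integral>x. \<bar>group_convolution \<mu> df g x\<bar> + \<bar>group_convolution \<mu> f' dg x\<bar> \<partial>\<mu>)"
    using assms df dg
    by (intro integral_mono_AE integrable_abs Bochner_Integration.integrable_diff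
        Bochner_Integration.integrable_add integrable_convolution)
  also have "\<dots> = (\<integral>x. \<bar>group_convolution \<mu> df g x\<bar> \<partial>\<mu>) + (\<integral>x. \<bar>group_convolution \<mu> f' dg x\<bar> \<partial>\<mu>)"
    using assms df dg
    by (intro Bochner_Integration.integral_add integrable_abs integrable_convolution)
  also have "\<dots> \<le> (\<integral>x. \<bar>df x\<bar> \<partial>\<mu>) * (\<integral>x. \<bar>g x\<bar> \<partial>\<mu>) + (\<integral>x. \<bar>f' x\<bar> \<partial>\<mu>) * (\<integral>x. \<bar>dg x\<bar> \<partial>\<mu>)"
    using assms df dg by (intro add_mono integral_abs_convolution_le)
  finally show ?thesis by (simp add: df_def dg_def)
qed

end

subsection \<open>The metric structure\<close>

lemma fun_interp_L1_structure:
  "fun_interp (L1_structure \<mu>) Plus Fs = L1_class \<mu> (\<lambda>x. (L1_rep (Fs ! 0) x + L1_rep (Fs ! 1) x) / 2)"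
  "fun_interp (L1_structure \<mu>) Zero Fs = L1_class \<mu> (\<lambda>_. 0)"
  "fun_interp (L1_structure \<mu>) Meet Fs = L1_class \<mu> (\<lambda>x. min (L1_rep (Fs ! 0) x) (L1_rep (Fs ! 1) x) / 2)"
  "fun_interp (L1_structure \<mu>) Join Fs = L1_class \<mu> (\<lambda>x. max (L1_rep (Fs ! 0) x) (L1_rep (Fs ! 1) x) / 2)"
  "fun_interp (L1_structure \<mu>) Convol Fs =
     L1_class \<mu> (group_convolution \<mu> (L1_rep (Fs ! 0)) (L1_rep (Fs ! 1)))"
  by (simp_all add: L1_structure_def L1_lift2_def)

lemma universe_L1_structure: "universe (L1_structure \<mu>) = L1_ball \<mu>"
  by (simp add: L1_structure_def L1_ball_def)

lemma distance_L1_structure: "distance (L1_structure \<mu>) = L1_dist \<mu>"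
  by (simp add: L1_structure_def)

lemma L1_ballD:
  assumes "F \<in> L1_ball \<mu>"
  shows "integrable \<mu> (L1_rep F)" "(\<integral>x. \<bar>L1_rep F x\<bar> \<partial>\<mu>) \<le> 1"
  using assms by (auto simp: L1_ball_def L1_norm_def integrable_L1_rep)

text \<open>Addition, minimum and maximum, each rescaled by 1/2, all satisfy the hypothesis on
  \<open>p\<close>, so the unit ball is closed under them.\<close>

lemma pointwise_op_norm_le:
  fixes p :: "real \<Rightarrow> real \<Rightarrow> real" and f g :: "'a \<Rightarrow> real"
  assumes p: "\<And>a b. \<bar>p a b\<bar> \<le> (\<bar>a\<bar> + \<bar>b\<bar>) / 2"
    and i: "integrable \<mu> (\<lambda>x. p (f x) (g x))" "integrable \<mu> f" "integrable \<mu> g"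
    and n: "(\<integral>x. \<bar>f x\<bar> \<partial>\<mu>) \<le> c" "(\<integral>x. \<bar>g x\<bar> \<partial>\<mu>) \<le> c"
  shows "(\<integral>x. \<bar>p (f x) (g x)\<bar> \<partial>\<mu>) \<le> c"
proof -
  have "(\<integral>x. \<bar>p (f x) (g x)\<bar> \<partial>\<mu>) \<le> (\<integral>x. (\<bar>f x\<bar> + \<bar>g x\<bar>) / 2 \<partial>\<mu>)"
    using i p by (intro integral_mono) auto
  also have "\<dots> = ((\<integral>x. \<bar>f x\<bar> \<partial>\<mu>) + (\<integral>x. \<bar>g x\<bar> \<partial>\<mu>)) / 2"
    using i by simp
  also have "\<dots> \<le> c" using n by simp
  finally show ?thesis .
qed

lemma pointwise_op_dist_le:
  fixes p :: "real \<Rightarrow> real \<Rightarrow> real" and f g f' g' :: "'a \<Rightarrow> real"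
  assumes p: "\<And>a b a' b'. \<bar>p a b - p a' b'\<bar> \<le> (\<bar>a - a'\<bar> + \<bar>b - b'\<bar>) / 2"
    and i: "integrable \<mu> (\<lambda>x. p (f x) (g x))" "integrable \<mu> (\<lambda>x. p (f' x) (g' x))"
      "integrable \<mu> f" "integrable \<mu> g" "integrable \<mu> f'" "integrable \<mu> g'"
    and n: "(\<integral>x. \<bar>f x - f' x\<bar> \<partial>\<mu>) \<le> c" "(\<integral>x. \<bar>g x - g' x\<bar> \<partial>\<mu>) \<le> c"
  shows "(\<integral>x. \<bar>p (f x) (g x) - p (f' x) (g' x)\<bar> \<partial>\<mu>) \<le> c"
proof -
  have "(\<integral>x. \<bar>p (f x) (g x) - p (f' x) (g' x)\<bar> \<partial>\<mu>)
      \<le> (\<integral>x. (\<bar>f x - f' x\<bar> + \<bar>g x - g' x\<bar>) / 2 \<partial>\<mu>)"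
    using i p by (intro integral_mono) auto
  also have "\<dots> = ((\<integral>x. \<bar>f x - f' x\<bar> \<partial>\<mu>) + (\<integral>x. \<bar>g x - g' x\<bar> \<partial>\<mu>)) / 2"
    using i by simp
  also have "\<dots> \<le> c" using n by simp
  finally show ?thesis .
qed

context haar_measure
begin

lemma fun_interp_in_L1_ball:
  assumes Fs: "Fs \<in> tuples (L1_ball \<mu>) (fun_arity L_cnv s)"
  shows "fun_interp (L1_structure \<mu>) s Fs \<in> L1_ball \<mu>"
proof (cases "s = Zero")
  case True
  then show ?thesis by (auto simp: fun_interp_L1_structure intro!: L1_class_in_L1_ball)
next
  case False
  then have len: "length Fs = 2" and sub: "set Fs \<subseteq> L1_ball \<mu>"
    using Fs by (auto simp: tuples_def L_cnv_def)
  then have "Fs ! 0 \<in> L1_ball \<mu>" "Fs ! 1 \<in> L1_ball \<mu>"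
    using nth_mem[of 0 Fs] nth_mem[of 1 Fs] by auto
  note r = L1_ballD[OF this(1)] L1_ballD[OF this(2)]
  show ?thesis
  proof (cases s)
    case Plus
    show ?thesis unfolding Plus fun_interp_L1_structure
      by (intro L1_class_in_L1_ball pointwise_op_norm_le[where p="\<lambda>a b. (a + b) / 2"] r)
        (use r in auto)
  next
    case Meet
    show ?thesis unfolding Meet fun_interp_L1_structure
      by (intro L1_class_in_L1_ball pointwise_op_norm_le[where p="\<lambda>a b. min a b / 2"] r)
        (use r in auto)
  next
    case Join
    show ?thesis unfolding Join fun_interp_L1_structure
      by (intro L1_class_in_L1_ball pointwise_op_norm_le[where p="\<lambda>a b. max a b / 2"] r)
        (use r in auto)
  next
    case Convol
    have "(\<integral>x. \<bar>L1_rep (Fs ! 0) x\<bar> \<partial>\<mu>) * (\<integral>x. \<bar>L1_rep (Fs ! 1) x\<bar> \<partial>\<mu>) \<le> 1 * 1"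
      using r by (intro mult_mono) auto
    then show ?thesis unfolding Convol fun_interp_L1_structure
      using r integral_abs_convolution_le[OF r(1,3)]
      by (intro L1_class_in_L1_ball integrable_convolution) auto
  qed (use False in simp)
qed

lemma fun_interp_uniformly_continuous:
  assumes Fs: "Fs \<in> tuples (L1_ball \<mu>) (fun_arity L_cnv s)"
    and Gs: "Gs \<in> tuples (L1_ball \<mu>) (fun_arity L_cnv s)"
    and d: "\<And>i. i < fun_arity L_cnv s \<Longrightarrow> L1_dist \<mu> (Fs ! i) (Gs ! i) < fun_modulus L_cnv s \<epsilon>"
    and \<epsilon>: "0 < \<epsilon>"
  shows "L1_dist \<mu> (fun_interp (L1_structure \<mu>) s Fs) (fun_interp (L1_structure \<mu>) s Gs) \<le> \<epsilon>"
proof (cases "s = Zero")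
  case True
  then show ?thesis using \<epsilon> by (simp add: fun_interp_L1_structure L1_dist_def)
next
  case False
  then have "length Fs = 2" "length Gs = 2" "set Fs \<subseteq> L1_ball \<mu>" "set Gs \<subseteq> L1_ball \<mu>"
    using Fs Gs by (auto simp: tuples_def L_cnv_def)
  then have "Fs ! 0 \<in> L1_ball \<mu>" "Fs ! 1 \<in> L1_ball \<mu>" "Gs ! 0 \<in> L1_ball \<mu>" "Gs ! 1 \<in> L1_ball \<mu>"
    using nth_mem[of 0 Fs] nth_mem[of 1 Fs] nth_mem[of 0 Gs] nth_mem[of 1 Gs] by auto
  note r = L1_ballD[OF this(1)] L1_ballD[OF this(2)] L1_ballD[OF this(3)] L1_ballD[OF this(4)]
  have ar: "fun_arity L_cnv s = 2" using False by (simp add: L_cnv_def)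
  have e: "(\<integral>x. \<bar>L1_rep (Fs ! 0) x - L1_rep (Gs ! 0) x\<bar> \<partial>\<mu>) < fun_modulus L_cnv s \<epsilon>"
    "(\<integral>x. \<bar>L1_rep (Fs ! 1) x - L1_rep (Gs ! 1) x\<bar> \<partial>\<mu>) < fun_modulus L_cnv s \<epsilon>"
    using d[of 0] d[of 1] by (simp_all add: ar L1_dist_def)
  have op: "L1_dist \<mu> (L1_class \<mu> (\<lambda>x. p (L1_rep (Fs ! 0) x) (L1_rep (Fs ! 1) x)))
      (L1_class \<mu> (\<lambda>x. p (L1_rep (Gs ! 0) x) (L1_rep (Gs ! 1) x))) \<le> \<epsilon>"
    if s: "s \<noteq> Convol" and p: "\<And>a b a' b'. \<bar>p a b - p a' b'\<bar> \<le> (\<bar>a - a'\<bar> + \<bar>b - b'\<bar>) / 2"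
      and i: "integrable \<mu> (\<lambda>x. p (L1_rep (Fs ! 0) x) (L1_rep (Fs ! 1) x))"
        "integrable \<mu> (\<lambda>x. p (L1_rep (Gs ! 0) x) (L1_rep (Gs ! 1) x))"
    for p :: "real \<Rightarrow> real \<Rightarrow> real"
    unfolding L1_dist_L1_class[OF i]
    using s e by (intro pointwise_op_dist_le[OF p i r(1,3,5,7)]) (auto simp: L_cnv_def)
  have lip: "\<bar>(a + b) / 2 - (a' + b') / 2\<bar> \<le> (\<bar>a - a'\<bar> + \<bar>b - b'\<bar>) / 2"
    "\<bar>min a b / 2 - min a' b' / 2\<bar> \<le> (\<bar>a - a'\<bar> + \<bar>b - b'\<bar>) / 2"
    "\<bar>max a b / 2 - max a' b' / 2\<bar> \<le> (\<bar>a - a'\<bar> + \<bar>b - b'\<bar>) / 2" for a b a' b' :: real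
    by (auto simp: abs_if min_def max_def field_simps)
  show ?thesis
  proof (cases s)
    case Plus
    show ?thesis unfolding Plus fun_interp_L1_structure
      using r by (intro op[of "\<lambda>a b. (a + b) / 2"] lip) (auto simp: Plus)
  next
    case Meet
    show ?thesis unfolding Meet fun_interp_L1_structure
      using r by (intro op[of "\<lambda>a b. min a b / 2"] lip) (auto simp: Meet)
  next
    case Join
    show ?thesis unfolding Join fun_interp_L1_structure
      using r by (intro op[of "\<lambda>a b. max a b / 2"] lip) (auto simp: Join)
  next
    case Convol
    then have e': "(\<integral>x. \<bar>L1_rep (Fs ! 0) x - L1_rep (Gs ! 0) x\<bar> \<partial>\<mu>) \<le> \<epsilon> / 2"
      "(\<integral>x. \<bar>L1_rep (Fs ! 1) x - L1_rep (Gs ! 1) x\<bar> \<partial>\<mu>) \<le> \<epsilon> / 2"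
      using e by (auto simp: L_cnv_def)
    have "(\<integral>x. \<bar>group_convolution \<mu> (L1_rep (Fs ! 0)) (L1_rep (Fs ! 1)) x
          - group_convolution \<mu> (L1_rep (Gs ! 0)) (L1_rep (Gs ! 1)) x\<bar> \<partial>\<mu>)
        \<le> (\<integral>x. \<bar>L1_rep (Fs ! 0) x - L1_rep (Gs ! 0) x\<bar> \<partial>\<mu>) * (\<integral>x. \<bar>L1_rep (Fs ! 1) x\<bar> \<partial>\<mu>)
          + (\<integral>x. \<bar>L1_rep (Gs ! 0) x\<bar> \<partial>\<mu>) * (\<integral>x. \<bar>L1_rep (Fs ! 1) x - L1_rep (Gs ! 1) x\<bar> \<partial>\<mu>)"
      by (rule convolution_lipschitz[OF r(1,3,5,7)])
    \<comment> \<open>Norms are at most 1, and the modulus \<open>\<epsilon> / 2\<close> of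
      \<open>Convol\<close> pays for the two terms.\<close>
    also have "\<dots> \<le> \<epsilon> / 2 * 1 + 1 * (\<epsilon> / 2)"
      using e' r \<epsilon> by (intro add_mono mult_mono) auto
    finally show ?thesis unfolding Convol fun_interp_L1_structure
      using r by (subst L1_dist_L1_class) (auto intro: integrable_convolution)
  qed (use False in simp)
qed

lemma metric_structure_L1_structure: "metric_structure L_cnv (L1_structure \<mu>)"
proof -
  have zero: "L1_class \<mu> (\<lambda>_. 0) \<in> L1_ball \<mu>" by (intro L1_class_in_L1_ball) auto
  have diam: "L1_dist \<mu> F G \<le> 2" if "F \<in> L1_ball \<mu>" "G \<in> L1_ball \<mu>" for F G
    using integral_abs_triangle[OF L1_ballD(1)[OF that(1)] integrable_zero L1_ballD(1)[OF that(2)]]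
      L1_ballD(2)[OF that(1)] L1_ballD(2)[OF that(2)]
    by (simp add: L1_dist_def)
  have norm: "\<bar>L1_norm \<mu> F - L1_norm \<mu> G\<bar> \<le> \<epsilon>"
    if FG: "F \<in> L1_ball \<mu>" "G \<in> L1_ball \<mu>" and d: "L1_dist \<mu> F G < \<epsilon>" for F G \<epsilon>
    using integral_abs_triangle[OF L1_ballD(1)[OF FG(1)] L1_ballD(1)[OF FG(2)] integrable_zero]
      integral_abs_triangle[OF L1_ballD(1)[OF FG(2)] L1_ballD(1)[OF FG(1)] integrable_zero] d
    by (simp add: L1_norm_def L1_dist_def abs_minus_commute)
  have rel: "rel_interp (L1_structure \<mu>) q Fs = L1_norm \<mu> (Fs ! 0)" for q Fs
    by (simp add: L1_structure_def)
  have nth: "Fs ! 0 \<in> L1_ball \<mu>" if "Fs \<in> tuples (L1_ball \<mu>) (Suc 0)" for Fs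
    using that nth_mem[of 0 Fs] by (auto simp: tuples_def)
  have range: "L1_norm \<mu> F \<in> {0..1}" if "F \<in> L1_ball \<mu>" for F
    using L1_ballD(2)[OF that] by (simp add: L1_norm_def)
  show ?thesis
    unfolding metric_structure_def universe_L1_structure distance_L1_structure rel
  proof (intro conjI)
    show "L1_ball \<mu> \<noteq> {}" using zero by blast
    show "Metric_space (L1_ball \<mu>) (L1_dist \<mu>)" by (rule Metric_space_L1_ball)
    show "Metric_space.mcomplete (L1_ball \<mu>) (L1_dist \<mu>)" by (rule mcomplete_L1_ball)
    show "\<forall>F\<in>L1_ball \<mu>. \<forall>G\<in>L1_ball \<mu>. L1_dist \<mu> F G \<le> diam_bound L_cnv"
      using diam by (simp add: L_cnv_def)
    show "\<forall>s. \<forall>Fs\<in>tuples (L1_ball \<mu>) (fun_arity L_cnv s). fun_interp (L1_structure \<mu>) s Fs \<in> L1_ball \<mu>"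
      using fun_interp_in_L1_ball by blast
    show "\<forall>s. \<forall>Fs\<in>tuples (L1_ball \<mu>) (fun_arity L_cnv s). \<forall>Gs\<in>tuples (L1_ball \<mu>) (fun_arity L_cnv s).
        \<forall>\<epsilon>>0. (\<forall>i<fun_arity L_cnv s. L1_dist \<mu> (Fs ! i) (Gs ! i) < fun_modulus L_cnv s \<epsilon>) \<longrightarrow>
          L1_dist \<mu> (fun_interp (L1_structure \<mu>) s Fs) (fun_interp (L1_structure \<mu>) s Gs) \<le> \<epsilon>"
      by (intro allI ballI impI fun_interp_uniformly_continuous) auto
    show "\<forall>r. \<forall>Fs\<in>tuples (L1_ball \<mu>) (rel_arity L_cnv r). L1_norm \<mu> (Fs ! 0) \<in> rel_range L_cnv r"
      using range nth by (simp add: L_cnv_def)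
    show "\<forall>r. \<forall>Fs\<in>tuples (L1_ball \<mu>) (rel_arity L_cnv r). \<forall>Gs\<in>tuples (L1_ball \<mu>) (rel_arity L_cnv r).
        \<forall>\<epsilon>>0. (\<forall>i<rel_arity L_cnv r. L1_dist \<mu> (Fs ! i) (Gs ! i) < rel_modulus L_cnv r \<epsilon>) \<longrightarrow>
          \<bar>L1_norm \<mu> (Fs ! 0) - L1_norm \<mu> (Gs ! 0)\<bar> \<le> \<epsilon>"
      using norm nth by (simp add: L_cnv_def)
  qed
qed

lemma is_model_L1_structure: "is_model L_cnv (Th L_cnv (L1_structure \<mu>)) (L1_structure \<mu>)"
  by (simp add: is_model_def metric_structure_L1_structure Th_def)

text \<open>The interpretation convolves chosen representatives. These differ from \<open>f\<close>
  and \<open>g\<close> by distance 0, so by \<open>convolution_lipschitz\<close> the convolutions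
  agree almost everywhere.\<close>

lemma L1_dist_convolution_classes:
  fixes f g :: "'a \<Rightarrow> real"
  assumes f: "integrable \<mu> f" and g: "integrable \<mu> g"
  shows "L1_dist \<mu> (L1_class \<mu> f) (fun_interp (L1_structure \<mu>) Convol [L1_class \<mu> f, L1_class \<mu> g])
    = (\<integral>x. \<bar>f x - group_convolution \<mu> f g x\<bar> \<partial>\<mu>)"
proof -
  let ?f = "L1_rep (L1_class \<mu> f)" and ?g = "L1_rep (L1_class \<mu> g)"
  note r = integrable_L1_rep_L1_class[OF f] integrable_L1_rep_L1_class[OF g]
  have "(\<integral>x. \<bar>?f x - f x\<bar> \<partial>\<mu>) = 0" "(\<integral>x. \<bar>?g x - g x\<bar> \<partial>\<mu>) = 0"
    using AE_L1_rep_L1_class[OF f] AE_L1_rep_L1_class[OF g] r f g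
    by (auto simp: integral_nonneg_eq_0_iff_AE)
  with convolution_lipschitz[OF r f g]
  have "(\<integral>x. \<bar>group_convolution \<mu> ?f ?g x - group_convolution \<mu> f g x\<bar> \<partial>\<mu>) = 0"
    by (intro antisym) auto
  then have "AE x in \<mu>. group_convolution \<mu> ?f ?g x = group_convolution \<mu> f g x"
    using integrable_convolution[OF r] integrable_convolution[OF f g]
    by (subst (asm) integral_nonneg_eq_0_iff_AE) auto
  then have "fun_interp (L1_structure \<mu>) Convol [L1_class \<mu> f, L1_class \<mu> g]
      = L1_class \<mu> (group_convolution \<mu> f g)"
    by (simp add: fun_interp_L1_structure L1_class_cong)
  then show ?thesis
    using L1_dist_L1_class[OF f integrable_convolution[OF f g]] by simp
qed

end

subsection \<open>Averages over small sets\<close>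

text \<open>A tube argument: by continuity each point (y, 0) has a rectangle that addition maps into
  \<open>W\<close>. Finitely many bases cover \<open>V\<close>, and the corresponding heights
  intersect in the required neighbourhood.\<close>

lemma open_nbhd_compact_add:
  fixes V :: "'a::topological_group_add set"
  assumes V: "compact V" and W: "open W" "V \<subseteq> W"
  shows "\<exists>U. open U \<and> 0 \<in> U \<and> (\<forall>y\<in>V. \<forall>u\<in>U. y + u \<in> W)"
proof -
  define S where "S = (\<lambda>p :: 'a \<times> 'a. fst p + snd p) -` W"
  have S: "open S" unfolding S_def using W(1) by (intro open_vimage continuous_intros)
  have "\<forall>y\<in>V. \<exists>A B. open A \<and> open B \<and> y \<in> A \<and> 0 \<in> B \<and> A \<times> B \<subseteq> S"
  proof
    fix y assume "y \<in> V"
    then have "(y, 0) \<in> S" using W(2) by (auto simp: S_def)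
    with S obtain A B where "open A" "open B" "(y, 0) \<in> A \<times> B" "A \<times> B \<subseteq> S"
      by (rule open_prod_elim)
    then show "\<exists>A B. open A \<and> open B \<and> y \<in> A \<and> 0 \<in> B \<and> A \<times> B \<subseteq> S" by blast
  qed
  then obtain A B where AB: "\<And>y. y \<in> V \<Longrightarrow> open (A y)" "\<And>y. y \<in> V \<Longrightarrow> open (B y)"
      "\<And>y. y \<in> V \<Longrightarrow> y \<in> A y" "\<And>y. y \<in> V \<Longrightarrow> 0 \<in> B y" "\<And>y. y \<in> V \<Longrightarrow> A y \<times> B y \<subseteq> S"
    by metis
  have "V \<subseteq> (\<Union>y\<in>V. A y)" using AB(3) by blast
  then obtain D where D: "D \<subseteq> V" "finite D" "V \<subseteq> (\<Union>y\<in>D. A y)"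
    using compactE_image[OF V, of V A] AB(1) by metis
  show ?thesis
  proof (intro exI[of _ "\<Inter>y\<in>D. B y"] conjI ballI)
    show "open (\<Inter>y\<in>D. B y)" using D AB(2) by auto
    show "0 \<in> (\<Inter>y\<in>D. B y)" using D AB(4) by auto
    fix y u assume y: "y \<in> V" and u: "u \<in> (\<Inter>y\<in>D. B y)"
    then obtain z where "z \<in> D" "y \<in> A z" using D(3) by blast
    then have "(y, u) \<in> S" using AB(5)[of z] D(1) u by blast
    then show "y + u \<in> W" by (simp add: S_def)
  qed
qed

text \<open>Pointwise |t| = 2 max(0, t) - t, and the linear terms cancel because the two integrals
  agree.\<close>

lemma integral_abs_diff_eq:
  fixes f c :: "'a \<Rightarrow> real"
  assumes f: "integrable M f" and c: "integrable M c" and eq: "(\<integral>x. f x \<partial>M) = (\<integral>x. c x \<partial>M)"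
  shows "(\<integral>x. \<bar>f x - c x\<bar> \<partial>M) = 2 * (\<integral>x. max 0 (f x - c x) \<partial>M)"
proof -
  have "(\<integral>x. \<bar>f x - c x\<bar> \<partial>M) = (\<integral>x. 2 * max 0 (f x - c x) - (f x - c x) \<partial>M)"
    by (intro Bochner_Integration.integral_cong) (auto simp: max_def)
  also have "\<dots> = 2 * (\<integral>x. max 0 (f x - c x) \<partial>M) - ((\<integral>x. f x \<partial>M) - (\<integral>x. c x \<partial>M))"
    using f c by simp
  finally show ?thesis using eq by simp
qed

context haar_measure
begin

definition average :: "'a set \<Rightarrow> 'a \<Rightarrow> real" where
  "average A x = indicator A x / measure \<mu> A"

lemma average_nonneg: "0 \<le> average A x"
  by (simp add: average_def)

lemma integrable_average:
  assumes "A \<in> sets \<mu>" "emeasure \<mu> A < \<infinity>"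
  shows "integrable \<mu> (average A)"
  unfolding average_def using assms by auto

lemma integral_average:
  assumes "A \<in> sets \<mu>" "0 < measure \<mu> A"
  shows "(\<integral>x. average A x \<partial>\<mu>) = 1"
  using assms by (simp add: average_def)

lemma L1_class_average_in_L1_ball:
  assumes "A \<in> sets \<mu>" "emeasure \<mu> A < \<infinity>" "0 < measure \<mu> A"
  shows "L1_class \<mu> (average A) \<in> L1_ball \<mu>"
  using assms by (intro L1_class_in_L1_ball integrable_average) (simp_all add: average_nonneg integral_average)

text \<open>
  Symmetry of \<open>U\<close> makes \<open>y \<mapsto> average U (- y + x)\<close> a left translate of \<open>average U\<close>, so that the modular
  function does not enter.
\<close>

context
  fixes V U :: "'a set"
  assumes V: "V \<in> sets \<mu>" "emeasure \<mu> V < \<infinity>" "0 < measure \<mu> V"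
    and U: "U \<in> sets \<mu>" "emeasure \<mu> U < \<infinity>" "0 < measure \<mu> U"
    and sym: "\<And>u. u \<in> U \<Longrightarrow> - u \<in> U"
begin

lemma convolution_average:
  "group_convolution \<mu> (average V) (average U) x
    = measure \<mu> (V \<inter> (\<lambda>y. - x + y) -` U) / (measure \<mu> V * measure \<mu> U)"
proof -
  have iff: "- y + x \<in> U \<longleftrightarrow> - x + y \<in> U" for y
    using sym[of "- y + x"] sym[of "- x + y"] by (auto simp: minus_add)
  have "group_convolution \<mu> (average V) (average U) x
      = (\<integral>y. indicator (V \<inter> (\<lambda>y. - x + y) -` U) y / (measure \<mu> V * measure \<mu> U) \<partial>\<mu>)"
    unfolding group_convolution_def average_def
    by (intro Bochner_Integration.integral_cong) (auto simp: indicator_def iff)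
  then show ?thesis by simp
qed

text \<open>The intersection is contained in \<open>V\<close> and in a left translate of
  \<open>U\<close>; each inclusion cancels one factor of the denominator.\<close>

lemma convolution_average_le:
  "group_convolution \<mu> (average V) (average U) x \<le> 1 / measure \<mu> V"
  "group_convolution \<mu> (average V) (average U) x \<le> 1 / measure \<mu> U"
proof -
  let ?T = "(\<lambda>y. - x + y) -` U"
  have T: "?T \<in> sets \<mu>"
    using measurable_sets[OF measurable_translate, of U "- x"] U(1) by (simp add: sets_mu)
  have mT: "emeasure \<mu> ?T = emeasure \<mu> U"
    using U(1) by (intro emeasure_vimage_translate) (simp add: sets_mu)
  have "measure \<mu> (V \<inter> ?T) \<le> measure \<mu> ?T"
    using T V U mT by (intro measure_mono_fmeasurable) (auto simp: fmeasurable_def)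
  also have "\<dots> = measure \<mu> U" using mT by (simp add: measure_def)
  finally show "group_convolution \<mu> (average V) (average U) x \<le> 1 / measure \<mu> V"
    using V U by (simp add: convolution_average field_simps)
  have "measure \<mu> (V \<inter> ?T) \<le> measure \<mu> V"
    using T V U by (intro measure_mono_fmeasurable) (auto simp: fmeasurable_def)
  then show "group_convolution \<mu> (average V) (average U) x \<le> 1 / measure \<mu> U"
    using V U by (simp add: convolution_average field_simps)
qed

lemma integrable_averages:
  "integrable \<mu> (average V)" "integrable \<mu> (group_convolution \<mu> (average V) (average U))"
  by (intro integrable_convolution integrable_average V U)+

lemma integral_averages:
  "(\<integral>x. average V x \<partial>\<mu>) = (\<integral>x. group_convolution \<mu> (average V) (average U) x \<partial>\<mu>)"
  "(\<integral>x. group_convolution \<mu> (average V) (average U) x \<partial>\<mu>) = 1"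
  using V U by (simp_all add: integral_convolution_nonneg integrable_average average_nonneg integral_average)

text \<open>On \<open>V\<close> the average equals 1/\<mu>(V) while the convolution is at most
  1/\<mu>(U). Integrating the gap over \<open>V\<close> bounds the positive part from below.\<close>

lemma dist_average_convolution_ge:
  "2 * (1 - measure \<mu> V / measure \<mu> U)
    \<le> (\<integral>x. \<bar>average V x - group_convolution \<mu> (average V) (average U) x\<bar> \<partial>\<mu>)"
proof -
  let ?c = "group_convolution \<mu> (average V) (average U)"
  have "1 - measure \<mu> V / measure \<mu> U = (\<integral>x. indicator V x * (1 / measure \<mu> V - 1 / measure \<mu> U) \<partial>\<mu>)"
    using V U by (simp add: field_simps)
  also have "\<dots> \<le> (\<integral>x. max 0 (average V x - ?c x) \<partial>\<mu>)"
  proof (rule integral_mono)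
    show "integrable \<mu> (\<lambda>x. indicator V x * (1 / measure \<mu> V - 1 / measure \<mu> U))"
      using V by auto
    show "integrable \<mu> (\<lambda>x. max 0 (average V x - ?c x))"
      using integrable_averages by auto
    fix x
    show "indicator V x * (1 / measure \<mu> V - 1 / measure \<mu> U) \<le> max 0 (average V x - ?c x)"
      using convolution_average_le(2)[of x] by (auto simp: average_def indicator_def)
  qed
  finally show ?thesis
    using integral_abs_diff_eq[OF integrable_averages integral_averages(1)] by simp
qed

lemma dist_average_convolution_le_2:
  "(\<integral>x. \<bar>average V x - group_convolution \<mu> (average V) (average U) x\<bar> \<partial>\<mu>) \<le> 2"
proof -
  let ?c = "group_convolution \<mu> (average V) (average U)"
  have c0: "0 \<le> ?c x" for x unfolding convolution_average by simp
  have "(\<integral>x. \<bar>average V x - ?c x\<bar> \<partial>\<mu>) \<le> (\<integral>x. average V x + ?c x \<partial>\<mu>)"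
    using integrable_averages c0 average_nonneg[of V] by (intro integral_mono) (auto simp: abs_le_iff add_increasing add_increasing2)
  also have "\<dots> = 2" using integrable_averages integral_averages by simp
  finally show ?thesis .
qed

text \<open>The convolution can exceed the average only on \<open>W - V\<close>: it vanishes off
  \<open>W\<close>, and on \<open>V\<close> the average already has the maximal value
  1/\<mu>(V).\<close>

lemma dist_average_convolution_le:
  assumes W: "W \<in> sets \<mu>" "emeasure \<mu> W < \<infinity>" and sub: "\<And>y u. y \<in> V \<Longrightarrow> u \<in> U \<Longrightarrow> y + u \<in> W"
  shows "(\<integral>x. \<bar>average V x - group_convolution \<mu> (average V) (average U) x\<bar> \<partial>\<mu>)
    \<le> 2 * (measure \<mu> (W - V) / measure \<mu> V)"
proof -
  let ?c = "group_convolution \<mu> (average V) (average U)"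
  have fin: "emeasure \<mu> (W - V) < \<infinity>"
    using emeasure_mono[of "W - V" W \<mu>] W by (auto intro: le_less_trans)
  have "(\<integral>x. max 0 (?c x - average V x) \<partial>\<mu>) \<le> (\<integral>x. indicator (W - V) x / measure \<mu> V \<partial>\<mu>)"
  proof (rule integral_mono)
    show "integrable \<mu> (\<lambda>x. max 0 (?c x - average V x))"
      using integrable_averages by auto
    show "integrable \<mu> (\<lambda>x. indicator (W - V) x / measure \<mu> V)"
      using W V fin by auto
    fix x
    have "?c x = 0" if "x \<notin> W"
    proof -
      have "V \<inter> (\<lambda>y. - x + y) -` U = {}"
      proof (rule equals0I)
        fix y assume "y \<in> V \<inter> (\<lambda>y. - x + y) -` U"
        \<comment> \<open>The element \<open>- (- x + y)\<close> equals \<open>- y + x\<close>, so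
          adding it to \<open>y\<close> gives \<open>x\<close>, which would put \<open>x\<close>
          into \<open>W\<close>.\<close>
        then have "y \<in> V" "- (- x + y) \<in> U" using sym by auto
        with sub[of y "- (- x + y)"] that show False by (simp add: minus_add)
      qed
      then show ?thesis by (simp add: convolution_average)
    qed
    then show "max 0 (?c x - average V x) \<le> indicator (W - V) x / measure \<mu> V"
      using convolution_average_le(1)[of x] V(3)
      by (cases "x \<in> W"; cases "x \<in> V") (auto simp: average_def)
  qed
  also have "\<dots> = measure \<mu> (W - V) / measure \<mu> V" using W V by simp
  finally show ?thesis
    using integral_abs_diff_eq[OF integrable_averages(2,1) integral_averages(1)[symmetric]]
    by (simp add: abs_minus_commute)
qed

end

section \<open>Neighbourhoods of the identity that nearly fix given averages\<close>

text \<open>The estimate is stated for all admissible \<open>U\<close> inside \<open>N\<close>, so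
  that finitely many such requirements can be met at once by intersecting.\<close>

lemma ex_approximate_unit:
  assumes V: "compact V" "0 < measure \<mu> V" and \<epsilon>: "0 < \<epsilon>"
  shows "\<exists>N. open N \<and> 0 \<in> N \<and> (\<forall>U. open U \<longrightarrow> 0 \<in> U \<longrightarrow> U \<subseteq> N \<longrightarrow> emeasure \<mu> U < \<infinity> \<longrightarrow>
    (\<forall>u\<in>U. - u \<in> U) \<longrightarrow>
    (\<integral>x. \<bar>average V x - group_convolution \<mu> (average V) (average U) x\<bar> \<partial>\<mu>) \<le> \<epsilon>)"
proof -
  \<comment> \<open>Chosen so that twice \<open>d / measure \<mu> V\<close> is
    \<open>\<epsilon>\<close>.\<close>
  define d where "d = \<epsilon> * measure \<mu> V / 2"
  have d: "0 < d" using V \<epsilon> by (simp add: d_def)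
  have Vs: "V \<in> sets \<mu>" "emeasure \<mu> V < \<infinity>" using V emeasure_compact by auto
  then have eV: "emeasure \<mu> V = ennreal (measure \<mu> V)"
    by (intro emeasure_eq_ennreal_measure) auto
  then have "emeasure \<mu> V < ennreal (measure \<mu> V + d)" using d by (simp add: ennreal_less_iff)
  then obtain W where W: "open W" "V \<subseteq> W" "emeasure \<mu> W < ennreal (measure \<mu> V + d)"
    using outer_regular[of V] Vs by (metis sets_mu)
  have Wf: "emeasure \<mu> W < \<infinity>" using W(3) by (rule less_trans) simp
  have "emeasure \<mu> W = ennreal (measure \<mu> W)"
    using Wf by (intro emeasure_eq_ennreal_measure) auto
  with W(3) have mW: "measure \<mu> W < measure \<mu> V + d" by (simp add: ennreal_less_iff)
  have "measure \<mu> (W - V) = measure \<mu> W - measure \<mu> V"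
    using W Vs Wf by (intro measure_Diff) auto
  with mW have WV: "measure \<mu> (W - V) \<le> d" by simp
  obtain N where N: "open N" "0 \<in> N" "\<forall>y\<in>V. \<forall>u\<in>N. y + u \<in> W"
    using open_nbhd_compact_add[OF V(1) W(1,2)] by blast
  show ?thesis
  proof (intro exI[of _ N] conjI allI impI N)
    fix U assume U: "open U" "0 \<in> U" "U \<subseteq> N" "emeasure \<mu> U < \<infinity>" and sym: "\<forall>u\<in>U. - u \<in> U"
    have "0 < emeasure \<mu> U" using U by (intro emeasure_open_pos) auto
    then have mU: "0 < measure \<mu> U"
      using U(4) by (simp add: measure_def enn2real_positive_iff less_top)
    have "(\<integral>x. \<bar>average V x - group_convolution \<mu> (average V) (average U) x\<bar> \<partial>\<mu>)
        \<le> 2 * (measure \<mu> (W - V) / measure \<mu> V)"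
      using Vs V U mU W Wf N sym by (intro dist_average_convolution_le) auto
    also have "\<dots> \<le> 2 * (d / measure \<mu> V)"
      using WV V(2) by (simp add: divide_right_mono)
    also have "\<dots> = \<epsilon>" using V(2) by (simp add: d_def)
    finally show "(\<integral>x. \<bar>average V x - group_convolution \<mu> (average V) (average U) x\<bar> \<partial>\<mu>) \<le> \<epsilon>" .
  qed
qed

lemma ex_common_approximate_unit:
  assumes V: "\<And>i. compact (V i)" "\<And>i. 0 < measure \<mu> (V i)" and \<epsilon>: "0 < \<epsilon>" and I: "finite I"
  shows "\<exists>U. open U \<and> emeasure \<mu> U < \<infinity> \<and> 0 < measure \<mu> U \<and> (\<forall>u\<in>U. - u \<in> U) \<and>
    (\<forall>i\<in>I. (\<integral>x. \<bar>average (V i) x - group_convolution \<mu> (average (V i)) (average U) x\<bar> \<partial>\<mu>) \<le> \<epsilon>)"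
proof -
  have "\<forall>i. \<exists>N. open N \<and> 0 \<in> N \<and> (\<forall>U. open U \<longrightarrow> 0 \<in> U \<longrightarrow> U \<subseteq> N \<longrightarrow> emeasure \<mu> U < \<infinity> \<longrightarrow>
      (\<forall>u\<in>U. - u \<in> U) \<longrightarrow>
      (\<integral>x. \<bar>average (V i) x - group_convolution \<mu> (average (V i)) (average U) x\<bar> \<partial>\<mu>) \<le> \<epsilon>)"
    using V \<epsilon> by (intro allI ex_approximate_unit)
  from choice[OF this] obtain N where
    N: "\<forall>i. open (N i) \<and> 0 \<in> N i \<and> (\<forall>U. open U \<longrightarrow> 0 \<in> U \<longrightarrow> U \<subseteq> N i \<longrightarrow> emeasure \<mu> U < \<infinity> \<longrightarrow>
      (\<forall>u\<in>U. - u \<in> U) \<longrightarrow>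
      (\<integral>x. \<bar>average (V i) x - group_convolution \<mu> (average (V i)) (average U) x\<bar> \<partial>\<mu>) \<le> \<epsilon>)" ..
  \<comment> \<open>Outer regularity at the identity provides the neighbourhood that keeps the
    measure of \<open>U\<close> finite.\<close>
  have "emeasure \<mu> {0} < \<infinity>" by (rule emeasure_compact) simp
  then obtain F where F: "open F" "{0} \<subseteq> F" "emeasure \<mu> F < \<infinity>"
    using outer_regular[of "{0}"] by auto
  define U0 where "U0 = F \<inter> (\<Inter>i\<in>I. N i)"
  have U0: "open U0" "0 \<in> U0" unfolding U0_def using F N I by auto
  \<comment> \<open>Intersecting with the set of inverses makes the neighbourhood symmetric.\<close>
  define U where "U = U0 \<inter> uminus -` U0"
  have U: "open U" "0 \<in> U" "\<forall>u\<in>U. - u \<in> U"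
    unfolding U_def using U0 by (auto intro!: open_Int open_vimage continuous_intros)
  have fU: "emeasure \<mu> U < \<infinity>"
    using emeasure_mono[of U F \<mu>] F by (auto simp: U_def U0_def intro: le_less_trans)
  have "0 < emeasure \<mu> U" using U by (intro emeasure_open_pos) auto
  then have mU: "0 < measure \<mu> U"
    using fU by (simp add: measure_def enn2real_positive_iff less_top)
  have "U \<subseteq> N i" if "i \<in> I" for i using that by (auto simp: U_def U0_def)
  with N U fU have "\<forall>i\<in>I. (\<integral>x. \<bar>average (V i) x - group_convolution \<mu> (average (V i)) (average U) x\<bar> \<partial>\<mu>) \<le> \<epsilon>"
    by simp
  with U fU mU show ?thesis by blast
qed

section \<open>Null points and small compact sets\<close>

text \<open>By invariance all points have equal mass. If it were positive, a neighbourhood of 0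
  inside a compact set, having finite measure, would be finite; then points would be open and the
  group discrete.\<close>

lemma emeasure_singleton_eq_0:
  assumes lc: "locally_compact_space (euclidean :: 'a topology)"
    and nd: "(euclidean :: 'a topology) \<noteq> discrete_topology UNIV"
  shows "emeasure \<mu> {0} = 0"
proof (rule ccontr)
  assume pos: "emeasure \<mu> {0} \<noteq> 0"
  obtain U K :: "'a set" where UK: "open U" "compact K" "0 \<in> U" "U \<subseteq> K"
  proof -
    have "\<exists>U K. open U \<and> compact K \<and> (0::'a) \<in> U \<and> U \<subseteq> K"
      using lc unfolding locally_compact_space_def by (simp add: compactin_euclidean_iff)
    then show thesis using that by blast
  qed
  have sing: "emeasure \<mu> {x} = emeasure \<mu> {0}" for x
  proof -
    have "(\<lambda>y. - x + y) -` {0} = {x}" by (simp add: vimage_translate)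
    then show ?thesis using emeasure_vimage_translate[of "{0}" "- x"] by simp
  qed
  have "finite U"
  proof (rule ccontr)
    assume inf: "infinite U"
    have le: "of_nat n * emeasure \<mu> {0} \<le> emeasure \<mu> K" for n
    proof -
      obtain T where T: "T \<subseteq> U" "finite T" "card T = n"
        using infinite_arbitrarily_large[OF inf] by blast
      have "emeasure \<mu> T = (\<Sum>x\<in>T. emeasure \<mu> {x})"
        using T by (intro emeasure_eq_sum_singleton) (auto simp: sets_mu)
      also have "\<dots> = (\<Sum>x\<in>T. emeasure \<mu> {0})" by (intro sum.cong refl sing)
      finally have "of_nat n * emeasure \<mu> {0} = emeasure \<mu> T" using T by simp
      also have "\<dots> \<le> emeasure \<mu> K" using T UK by (intro emeasure_mono) auto
      finally show ?thesis .
    qed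
    have fin: "emeasure \<mu> K < \<infinity>" "emeasure \<mu> {0} < \<infinity>"
      by (rule emeasure_compact, use UK in simp)+
    then obtain k z where kz: "emeasure \<mu> K = ennreal k" "emeasure \<mu> {0} = ennreal z" "0 \<le> k" "0 \<le> z"
      by (metis ennreal_cases infinity_ennreal_def less_irrefl)
    with pos have z: "0 < z" by (auto simp: less_le)
    obtain n :: nat where n: "k < real n * z" using z reals_Archimedean3 by blast
    have "ennreal (real n * z) \<le> ennreal k"
      using le[of n] kz by (simp add: ennreal_mult ennreal_of_nat_eq_real_of_nat)
    then show False using n kz by simp
  qed
  \<comment> \<open>Finite subsets of a Hausdorff space are closed, so the other points of
    \<open>U\<close> may be removed.\<close>
  then have "open (U - (U - {0}))"
    using UK by (intro open_Diff finite_imp_closed) auto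
  moreover have "U - (U - {0}) = {0}" using UK by auto
  ultimately have o0: "open {0::'a}" by simp
  have ox: "open {x}" for x :: 'a
  proof -
    have "(\<lambda>y. - x + y) -` {0} = {x}" by (simp add: vimage_translate)
    moreover have "open ((\<lambda>y. - x + y) -` {0})"
      using o0 by (intro open_vimage continuous_intros)
    ultimately show ?thesis by simp
  qed
  have "open S" for S :: "'a set"
  proof -
    have "open (\<Union>x\<in>S. {x})" using ox by blast
    then show ?thesis by simp
  qed
  then have "(euclidean :: 'a topology) = discrete_topology UNIV"
    by (simp add: topology_eq)
  with nd show False by simp
qed

text \<open>Outer regularity at the null point 0 gives a small open set, which has positive measure;
  inner regularity finds a compact set of positive measure inside it.\<close>

lemma ex_small_compact:
  assumes lc: "locally_compact_space (euclidean :: 'a topology)"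
    and nd: "(euclidean :: 'a topology) \<noteq> discrete_topology UNIV" and \<epsilon>: "0 < \<epsilon>"
  shows "\<exists>V. compact V \<and> 0 < measure \<mu> V \<and> measure \<mu> V < \<epsilon>"
proof -
  have "emeasure \<mu> {0} < ennreal \<epsilon>" using emeasure_singleton_eq_0[OF lc nd] \<epsilon> by simp
  then obtain U where U: "open U" "{0} \<subseteq> U" "emeasure \<mu> U < ennreal \<epsilon>"
    by (rule outer_regular[rotated]) simp_all
  then have "0 < emeasure \<mu> U" by (intro emeasure_open_pos) auto
  then obtain V where V: "compact V" "V \<subseteq> U" "0 < emeasure \<mu> V"
    using inner_regular[OF U(1)] by blast
  have "emeasure \<mu> V \<le> emeasure \<mu> U" using V U by (intro emeasure_mono) auto
  then have "emeasure \<mu> V < ennreal \<epsilon>" using U(3) by simp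
  moreover have "emeasure \<mu> V = ennreal (measure \<mu> V)"
    using emeasure_compact[OF V(1)] by (intro emeasure_eq_ennreal_measure) auto
  ultimately show ?thesis using V by (intro exI[of _ V]) (simp add: ennreal_less_iff)
qed

end

section \<open>The double sequence of distances and its two iterated limits\<close>

theorem proposition4p25:
  fixes \<mu> :: "'a::{topological_group_add, t2_space} measure"
  assumes "locally_compact_space (euclidean :: 'a topology)"
    and "(euclidean :: 'a topology) \<noteq> discrete_topology UNIV"
    and "left_haar_measure \<mu>"
  shows "unstable TYPE(('a \<Rightarrow> real) set) L_cnv (Th L_cnv (L1_structure \<mu>)) 0 1
           (Dist (Var 0) (Fn Convol [Var 0, Var 1]))"
proof -
  interpret haar_measure \<mu> by unfold_locales (rule assms(3))
  have "\<forall>n. \<exists>V. compact V \<and> 0 < measure \<mu> V \<and> measure \<mu> V < inverse (real (Suc n))"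
    by (intro allI ex_small_compact assms) simp
  from choice[OF this] obtain V where
    "\<forall>n. compact (V n) \<and> 0 < measure \<mu> (V n) \<and> measure \<mu> (V n) < inverse (real (Suc n))" ..
  then have V: "\<And>n. compact (V n)" "\<And>n. 0 < measure \<mu> (V n)"
      "\<And>n. measure \<mu> (V n) < inverse (real (Suc n))"
    by auto
  have Vs: "V n \<in> sets \<mu>" "emeasure \<mu> (V n) < \<infinity>" for n
    using V(1) emeasure_compact by auto
  define dist_av where "dist_av n U =
    (\<integral>x. \<bar>average (V n) x - group_convolution \<mu> (average (V n)) (average U) x\<bar> \<partial>\<mu>)" for n U
  have "\<forall>m. \<exists>U. open U \<and> emeasure \<mu> U < \<infinity> \<and> 0 < measure \<mu> U \<and> (\<forall>u\<in>U. - u \<in> U) \<and>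
      (\<forall>n\<in>{..m}. dist_av n U \<le> inverse (real (Suc m)))"
    unfolding dist_av_def by (intro allI ex_common_approximate_unit V) auto
  from choice[OF this] obtain U where "\<forall>m. open (U m) \<and> emeasure \<mu> (U m) < \<infinity> \<and>
      0 < measure \<mu> (U m) \<and> (\<forall>u\<in>U m. - u \<in> U m) \<and>
      (\<forall>n\<in>{..m}. dist_av n (U m) \<le> inverse (real (Suc m)))" ..
  then have U: "\<And>m. open (U m)" "\<And>m. emeasure \<mu> (U m) < \<infinity>" "\<And>m. 0 < measure \<mu> (U m)"
      "\<And>m u. u \<in> U m \<Longrightarrow> - u \<in> U m"
      and small: "\<And>n m. n \<le> m \<Longrightarrow> dist_av n (U m) \<le> inverse (real (Suc m))"
    by auto
  have Us: "U m \<in> sets \<mu>" for m using U(1) by blast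
  define a where "a n = L1_class \<mu> (average (V n))" for n
  define b where "b m = L1_class \<mu> (average (U m))" for m
  have v: "eval (L1_structure \<mu>) ((\<lambda>_. undefined)(0 := a n, 1 := b m))
      (Dist (Var 0) (Fn Convol [Var 0, Var 1])) = dist_av n (U m)" for n m
    using L1_dist_convolution_classes[OF integrable_average[OF Vs] integrable_average[OF Us U(2)], of n m]
    by (simp add: distance_L1_structure dist_av_def a_def b_def)
  have "(\<lambda>m. dist_av n (U m)) \<longlonglongrightarrow> 0" for n
  proof (rule tendsto_sandwich)
    show "\<forall>\<^sub>F m in sequentially. 0 \<le> dist_av n (U m)" by (simp add: dist_av_def)
    \<comment> \<open>\<open>small\<close> covers only \<open>m\<close> at least \<open>n\<close>,
      which is enough for an eventual bound.\<close>
    show "\<forall>\<^sub>F m in sequentially. dist_av n (U m) \<le> inverse (real (Suc m))"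
      using small by (auto simp: eventually_sequentially)
    show "(\<lambda>m. inverse (real (Suc m))) \<longlonglongrightarrow> 0" by (rule LIMSEQ_inverse_real_of_nat)
  qed simp
  moreover have "(\<lambda>n. dist_av n (U m)) \<longlonglongrightarrow> 2" for m
  proof (rule tendsto_sandwich)
    show "\<forall>\<^sub>F n in sequentially. 2 * (1 - measure \<mu> (V n) / measure \<mu> (U m)) \<le> dist_av n (U m)"
      unfolding dist_av_def using Vs V(2) Us U
      by (intro always_eventually allI dist_average_convolution_ge) auto
    show "\<forall>\<^sub>F n in sequentially. dist_av n (U m) \<le> 2"
      unfolding dist_av_def using Vs V(2) Us U
      by (intro always_eventually allI dist_average_convolution_le_2) auto
    have "(\<lambda>n. measure \<mu> (V n)) \<longlonglongrightarrow> 0"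
      using V(2,3) by (intro tendsto_sandwich[OF _ _ tendsto_const LIMSEQ_inverse_real_of_nat])
        (auto intro!: always_eventually less_imp_le)
    \<comment> \<open>For fixed \<open>m\<close> the denominator is a positive constant while the
      measure of \<open>V n\<close> tends to 0.\<close>
    then have "(\<lambda>n. 2 * (1 - measure \<mu> (V n) / measure \<mu> (U m))) \<longlonglongrightarrow> 2 * (1 - 0 / measure \<mu> (U m))"
      using U(3)[of m] by (intro tendsto_intros) auto
    then show "(\<lambda>n. 2 * (1 - measure \<mu> (V n) / measure \<mu> (U m))) \<longlonglongrightarrow> 2" by simp
  qed simp
  moreover have "range a \<subseteq> universe (L1_structure \<mu>)" "range b \<subseteq> universe (L1_structure \<mu>)"
    using L1_class_average_in_L1_ball Vs V(2) Us U by (auto simp: universe_L1_structure a_def b_def)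
  ultimately show ?thesis
    unfolding unstable_def Let_def
    using is_model_L1_structure
    by (intro exI[of _ "L1_structure \<mu>"] exI[of _ a] exI[of _ b] conjI exI[of _ "\<lambda>_. 0"]
        exI[of _ "\<lambda>_. 2"] exI[of _ 0] exI[of _ 2]) (simp_all only: v tendsto_const zero_neq_numeral, simp_all)
qed

end
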